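(* Let $f,g:\mathbb{R}^n\to\mathbb{R}$ be proper, convex, lower semicontinuous and $L$-Lipschitz, with $\arg\min(f+g)\neq\emptyset$. Fix $t>0$, and let $(\delta_k)_{k\ge1}$, $(\alpha_k)_{k\ge1}$ be real sequences and $(N_k)_{k\ge1}$ a sequence of positive integers such that: (1) $\delta_k>0$, $\alpha_k\in(0,1)$, $\sum_{k=1}^\infty\sqrt{\delta_k}<\infty$ and $\sum_{k=1}^\infty\alpha_k<\infty$; (2) with $J_k=\exp\left(\frac{2}{\delta_k}L^2t\right)$ and $M_k=nt\delta_k+\left(2\sqrt{nt\delta_k}+3Lt\right)^2$, one has $N_k\ge\frac{8J_k}{\alpha_k}$ for all $k$ and $\sum_{k=1}^\infty\left(\sqrt{\frac{8J_kM_k}{\alpha_kN_k}}+\sqrt{n\,t\,\delta_k}\right)<\infty$. Let $z_1\in\mathbb{R}^n$ and consider the random iteration, for $k\ge1$, $$x_{k+1/2}=\widehat{\operatorname{prox}}^{\delta_k}_{tf}(z_k),\qquad x_{k+1}=\widehat{\operatorname{prox}}^{\delta_k}_{tg}(2x_{k+1/2}-z_k),\qquad z_{k+1}=z_k+x_{k+1}-x_{k+1/2},$$ where both estimators at iteration $k$ use $N_k$ samples. Then, almost surely, $x_k$ converges to a minimizer of $f+g$.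
   Context: For $F:\mathbb{R}^n\to\mathbb{R}$, $t,\delta>0$ and $x\in\mathbb{R}^n$, the sampled Hamilton-Jacobi proximal estimator with $N$ samples is $$\widehat{\operatorname{prox}}^{\delta}_{tF}(x)=\frac{\sum_{i=1}^N Z_i\exp(-F(Z_i)/\delta)}{\sum_{i=1}^N \exp(-F(Z_i)/\delta)},\qquad Z_1,\dots,Z_N\text{ i.i.d. }\sim\mathcal{N}(x,\delta tI_n).$$ In the iteration, fresh samples are drawn at every evaluation: conditionally on all samples drawn earlier, the samples used are i.i.d. with the stated Gaussian law centered at the current (random) argument. *)

theory Defs
  imports "HOL-Probability.Probability"
begin

definition proper_fun :: "('a \<Rightarrow> ereal) \<Rightarrow> bool" where
  "proper_fun F \<longleftrightarrow> (\<forall>x. F x \<noteq> -\<infinity>) \<and> (\<exists>x. F x \<noteq> \<infinity>)"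

definition lower_semicontinuous :: "('a::topological_space \<Rightarrow> ereal) \<Rightarrow> bool" where
  "lower_semicontinuous F \<longleftrightarrow> (\<forall>x. F x \<le> Liminf (at x) F)"

text \<open>The normal distribution with mean \<open>m\<close> and covariance matrix \<open>v\<close> times the
  identity, so that \<open>v > 0\<close> is a variance and not a standard deviation.\<close>

definition isotropic_gaussian :: "real^'n \<Rightarrow> real \<Rightarrow> (real^'n) measure" where
  "isotropic_gaussian m v =
     density lborel (\<lambda>z. ennreal (exp (- (norm (z - m))\<^sup>2 / (2 * v)) / sqrt (2 * pi * v) ^ CARD('n)))"

definition prox_estimator ::
  "(real^'n \<Rightarrow> real) \<Rightarrow> real \<Rightarrow> nat \<Rightarrow> (nat \<Rightarrow> real^'n) \<Rightarrow> real^'n" where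
  "prox_estimator F \<delta> N Z =
     (\<Sum>i=1..N. exp (- F (Z i) / \<delta>) *\<^sub>R Z i) /\<^sub>R (\<Sum>i=1..N. exp (- F (Z i) / \<delta>))"

definition generated_algebra ::
  "'w measure \<Rightarrow> ('w \<Rightarrow> 'b::topological_space) set \<Rightarrow> 'w measure" where
  "generated_algebra M S =
     sigma (space M) {X -` A \<inter> space M | X A. X \<in> S \<and> A \<in> sets borel}"

text \<open>Conditionally on \<open>\<G>\<close>, the random vectors \<open>Z 1, \<dots>, Z N\<close> are independent,
  each with law \<open>isotropic_gaussian (C \<omega>) v\<close> (the centre \<open>C\<close> is random): the conditional
  probability of every measurable rectangle is the product of the Gaussian probabilities.\<close>

definition cond_iid_gaussian ::
  "'w measure \<Rightarrow> 'w measure \<Rightarrow> ('w \<Rightarrow> real^'n) \<Rightarrow> real \<Rightarrow> nat \<Rightarrow> (nat \<Rightarrow> 'w \<Rightarrow> real^'n) \<Rightarrow> bool" where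
  "cond_iid_gaussian M \<G> C v N Z \<longleftrightarrow>
     (\<forall>i\<in>{1..N}. Z i \<in> borel_measurable M) \<and>
     (\<forall>A. (\<forall>i\<in>{1..N}. A i \<in> sets borel) \<longrightarrow>
        (AE \<omega> in M. real_cond_exp M \<G> (indicator {\<omega> \<in> space M. \<forall>i\<in>{1..N}. Z i \<omega> \<in> A i}) \<omega>
           = (\<Prod>i=1..N. measure (isotropic_gaussian (C \<omega>) v) (A i))))"

text \<open>All samples of iterations \<open>1, \<dots>, k - 1\<close>, where \<open>Y j i\<close> and \<open>W j i\<close> are the
  \<open>i\<close>-th samples of the first and of the second estimator of iteration \<open>j\<close>.\<close>

definition samples_before ::
  "(nat \<Rightarrow> nat) \<Rightarrow> (nat \<Rightarrow> nat \<Rightarrow> 'w \<Rightarrow> 'b) \<Rightarrow> (nat \<Rightarrow> nat \<Rightarrow> 'w \<Rightarrow> 'b) \<Rightarrow> nat \<Rightarrow> ('w \<Rightarrow> 'b) set" where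
  "samples_before N Y W k = (\<Union>j\<in>{1..<k}. \<Union>i\<in>{1..N j}. {Y j i, W j i})"

end

theory Submission
  imports Defs
begin

text \<open>
  The exact Douglas--Rachford operator \<open>T\<close> is firmly nonexpansive, and a minimizer of \<open>f + g\<close> yields
  a fixed point of \<open>T\<close>, so an iteration of \<open>T\<close> with summable errors converges. It remains to see that
  almost surely the errors of the sampled proximal points are summable. For a convex Lipschitz \<open>F\<close> with
  proximal point \<open>p\<close> of \<open>c\<close>, the subgradient \<open>(c - p) / t\<close> turns the measure with density
  \<open>exp (- F / \<delta>)\<close> relative to the Gaussian around \<open>c\<close> into a log-concave perturbation of the Gaussian
  around \<open>p\<close>. Hence its mean is within \<open>O(\<surd>\<delta>)\<close> of \<open>p\<close>, and the second moments of the weights exceed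
  the square of their mean by at most a constant multiple of \<open>J\<close>. Chebyshev's inequality for the
  numerator and the denominator of the estimator bounds the conditional probability of a large error by
  a multiple of \<open>\<alpha>\<close>, and the Borel--Cantelli lemma concludes.
\<close>

subsection \<open>Proximal maps and the Douglas--Rachford iteration\<close>

text \<open>The probabilistic estimates have to be uniform in the random centre. They are, because
  the subgradient at a proximal point has norm at most \<open>L\<close>: centre and proximal point
  are never further apart than \<open>t * L\<close>, so one set of constants serves wherever the
  iterates wander. The estimator is a ratio whose random denominator may be small, which makes
  mean-square bounds on its error awkward; bounds in probability suffice, since finitely many bad
  iterations do not affect summability. Deviations are measured directly from the proximal point
  instead of from the mean of the weighted law, so that the bias appears as the mean of the
  numerator. Constants that depend on the dimension alone, such as
  \<open>8 / 3 * 2 ^ CARD('n)\<close>, are harmless: they only multiply the summable sequences of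
  the hypotheses. In the final count, \<open>N k \<ge> 8 * J k / \<alpha> k\<close> controls the
  denominator, and the square root in \<open>err_sum\<close> that contains \<open>J\<close> and
  \<open>B\<close> is the tolerance for the numerator.\<close>

definition subgradient :: "('a::real_inner \<Rightarrow> real) \<Rightarrow> 'a \<Rightarrow> 'a \<Rightarrow> bool" where
  "subgradient F p s \<longleftrightarrow> (\<forall>u. F p + s \<bullet> (u - p) \<le> F u)"

text \<open>The optimality condition for minimizing
  \<open>F u + (norm (u - z))\<^sup>2 / (2 * t)\<close> serves as the definition, since later
  arguments use only the subgradient \<open>(z - p) /\<^sub>R t\<close>. Existence is
  \<open>ex_prox\<close>; uniqueness comes from \<open>subgradient_resolvent_firm\<close>.\<close>

definition prox :: "real \<Rightarrow> ('a::real_inner \<Rightarrow> real) \<Rightarrow> 'a \<Rightarrow> 'a" where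
  "prox t F z = (SOME p. subgradient F p ((z - p) /\<^sub>R t))"

definition firmly_nonexpansive :: "('a::real_inner \<Rightarrow> 'a) \<Rightarrow> bool" where
  "firmly_nonexpansive T \<longleftrightarrow> (\<forall>y z. (norm (T z - T y))\<^sup>2 \<le> (T z - T y) \<bullet> (z - y))"

lemma subgradientD: "subgradient F p s \<Longrightarrow> F p + s \<bullet> (u - p) \<le> F u"
  by (simp add: subgradient_def)

lemma subgradient_monotone:
  assumes "subgradient F p s" "subgradient F q r"
  shows "0 \<le> (s - r) \<bullet> (p - q)"
proof -
  have "F p + s \<bullet> (q - p) \<le> F q" "F q + r \<bullet> (p - q) \<le> F p"
    using assms by (auto simp: subgradient_def)
  then show ?thesis by (simp add: inner_simps inner_commute)
qed

text \<open>Moving from \<open>p\<close> by the vector \<open>s\<close> itself raises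
  \<open>F\<close> by at least the square of \<open>norm s\<close>, while the Lipschitz bound allows
  at most \<open>L * norm s\<close>.\<close>

lemma norm_subgradient_le:
  assumes "subgradient F p s" "lipschitz_on L UNIV F"
  shows "norm s \<le> L"
proof -
  have "F p + s \<bullet> s \<le> F (p + s)"
    using subgradientD[OF assms(1), of "p + s"] by simp
  moreover have "\<bar>F (p + s) - F p\<bar> \<le> L * norm s"
    using lipschitz_onD[OF assms(2), of "p + s" p] by (simp add: dist_norm)
  ultimately have "norm s * norm s \<le> L * norm s"
    by (simp add: dot_square_norm power2_eq_square)
  then show ?thesis
    using lipschitz_on_nonneg[OF assms(2)] by (cases "norm s = 0") auto
qed

lemma ex_prox:
  fixes F :: "'a::euclidean_space \<Rightarrow> real"
  assumes F: "convex_on UNIV F" "lipschitz_on L UNIV F" and t: "t > 0"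
  shows "\<exists>p. subgradient F p ((z - p) /\<^sub>R t)"
proof -
  have L: "L \<ge> 0" using lipschitz_on_nonneg[OF F(2)] .
  define \<phi> where "\<phi> u = F u + (norm (u - z))\<^sup>2 / (2 * t)" for u
  have contF: "continuous_on UNIV F" using lipschitz_on_continuous_on[OF F(2)] .
  \<comment> \<open>At a distance \<open>r > 2 * t * L\<close> from \<open>z\<close> the quadratic
    term \<open>r\<^sup>2 / (2 * t)\<close> exceeds the largest possible decrease
    \<open>L * r\<close> of \<open>F\<close>, so a minimum over this ball is global.\<close>
  have "continuous_on (cball z (2 * t * L)) \<phi>"
    unfolding \<phi>_def by (intro continuous_intros continuous_on_subset[OF contF]) (use t in auto)
  moreover have "cball z (2 * t * L) \<noteq> {}"
    using mult_nonneg_nonneg[OF L less_imp_le[OF t]] by (simp add: mult.commute)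
  ultimately obtain p where p: "p \<in> cball z (2 * t * L)"
    "\<And>u. u \<in> cball z (2 * t * L) \<Longrightarrow> \<phi> p \<le> \<phi> u"
    using continuous_attains_inf[of "cball z (2 * t * L)" \<phi>] by auto
  have min: "\<phi> p \<le> \<phi> u" for u
  proof (cases "u \<in> cball z (2 * t * L)")
    case False
    then have r: "2 * t * L < norm (u - z)" by (simp add: dist_norm norm_minus_commute)
    have "\<phi> p \<le> \<phi> z" by (rule p) (use mult_nonneg_nonneg[OF L less_imp_le[OF t]] in \<open>simp add: mult.commute\<close>)
    also have "\<phi> z = F z" by (simp add: \<phi>_def)
    also have "F z \<le> F u + L * norm (u - z)"
      using lipschitz_onD[OF F(2), of z u] by (simp add: dist_norm norm_minus_commute)
    also have "L * norm (u - z) \<le> (norm (u - z))\<^sup>2 / (2 * t)"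
      using mult_right_mono[of "2 * t * L" "norm (u - z)" "norm (u - z)"] r t
      by (simp add: field_simps power2_eq_square)
    finally show ?thesis by (simp add: \<phi>_def)
  qed (use p in auto)
  have "F p + ((z - p) /\<^sub>R t) \<bullet> (u - p) \<le> F u" for u
  proof -
    \<comment> \<open>\<open>\<eta>\<close> is the defect in the subgradient inequality and
      \<open>b\<close> the second-order term. Minimality against
      \<open>p + l *\<^sub>R (u - p)\<close>, divided by \<open>l\<close>, gives
      \<open>\<eta> \<le> l * b\<close>, and \<open>l\<close> tends to 0; convexity along the
      segment replaces differentiability.\<close>
    define b where "b = (norm (u - p))\<^sup>2 / (2 * t)"
    define \<eta> where "\<eta> = F p + ((z - p) /\<^sub>R t) \<bullet> (u - p) - F u"
    have le: "\<eta> \<le> l * b" if l: "0 < l" "l \<le> 1" for l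
    proof -
      have "\<phi> p \<le> \<phi> (p + l *\<^sub>R (u - p))" by (rule min)
      moreover have "F (p + l *\<^sub>R (u - p)) \<le> (1 - l) * F p + l * F u"
        using convex_onD[OF F(1), of l p u] l by (simp add: algebra_simps)
      moreover have "(norm (p + l *\<^sub>R (u - p) - z))\<^sup>2 =
          (norm (p - z))\<^sup>2 + (- 2 * l * ((z - p) \<bullet> (u - p)) + l\<^sup>2 * (norm (u - p))\<^sup>2)"
        by (simp only: power2_norm_eq_inner)
          (simp add: inner_simps inner_commute power2_eq_square algebra_simps)
      ultimately have "0 \<le> l * (F u - F p) + (- 2 * l * ((z - p) \<bullet> (u - p)) + l\<^sup>2 * (norm (u - p))\<^sup>2) / (2 * t)"
        unfolding \<phi>_def by (simp only: add_divide_distrib[of "(norm (p - z))\<^sup>2"]) (simp only: right_diff_distrib left_diff_distrib)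
      also have "\<dots> = l * (l * b - \<eta>)"
        unfolding b_def \<eta>_def inner_scaleR_left using t by (simp add: field_simps power2_eq_square)
      finally show ?thesis using l by (simp add: zero_le_mult_iff)
    qed
    have "((\<lambda>l. l * b) \<longlongrightarrow> 0 * b) (at_right 0)" by (intro tendsto_intros)
    moreover have "eventually (\<lambda>l. \<eta> \<le> l * b) (at_right 0)"
      using le by (auto simp: eventually_at_right[of 0 1] intro!: exI[of _ 1])
    ultimately have "\<eta> \<le> 0 * b" by (intro tendsto_lowerbound) auto
    then show ?thesis by (simp add: \<eta>_def)
  qed
  then show ?thesis unfolding subgradient_def by auto
qed

lemma subgradient_prox:
  fixes F :: "'a::euclidean_space \<Rightarrow> real"
  assumes "convex_on UNIV F" "lipschitz_on L UNIV F" "t > 0"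
  shows "subgradient F (prox t F z) ((z - prox t F z) /\<^sub>R t)"
  unfolding prox_def by (rule someI_ex) (rule ex_prox[OF assms])

text \<open>Monotonicity of subgradients, multiplied by \<open>t\<close>. Stated for arbitrary
  points satisfying the inclusion, it yields uniqueness of the proximal point for
  \<open>z = y\<close> and firm nonexpansiveness of \<open>prox\<close> in general.\<close>

lemma subgradient_resolvent_firm:
  assumes "subgradient F p ((z - p) /\<^sub>R t)" "subgradient F q ((y - q) /\<^sub>R t)" "t > 0"
  shows "(norm (p - q))\<^sup>2 \<le> (p - q) \<bullet> (z - y)"
proof -
  have "0 \<le> t * (((z - p) /\<^sub>R t - (y - q) /\<^sub>R t) \<bullet> (p - q))"
    using subgradient_monotone[OF assms(1,2)] assms(3) by simp
  also have "\<dots> = ((z - p) - (y - q)) \<bullet> (p - q)"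
    using assms(3) by (simp add: inner_simps field_simps)
  finally show ?thesis by (simp only: power2_norm_eq_inner) (simp add: inner_simps inner_commute)
qed

lemma prox_eqI:
  fixes F :: "'a::euclidean_space \<Rightarrow> real"
  assumes "convex_on UNIV F" "lipschitz_on L UNIV F" "t > 0"
    and "subgradient F p ((z - p) /\<^sub>R t)"
  shows "prox t F z = p"
  using subgradient_resolvent_firm[OF subgradient_prox[OF assms(1-3), of z] assms(4,3)] by simp

lemma firmly_nonexpansive_prox:
  fixes F :: "'a::euclidean_space \<Rightarrow> real"
  assumes "convex_on UNIV F" "lipschitz_on L UNIV F" "t > 0"
  shows "firmly_nonexpansive (prox t F)"
  unfolding firmly_nonexpansive_def
  using subgradient_resolvent_firm subgradient_prox[OF assms] assms(3) by blast

lemma firmly_nonexpansive_imp_nonexpansive: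
  assumes "firmly_nonexpansive T"
  shows "norm (T z - T y) \<le> norm (z - y)"
proof -
  have "(norm (T z - T y))\<^sup>2 \<le> norm (T z - T y) * norm (z - y)"
    using assms norm_cauchy_schwarz order_trans unfolding firmly_nonexpansive_def by blast
  then show ?thesis
    by (cases "T z = T y") (auto simp: power2_eq_square)
qed

lemma firmly_nonexpansive_imp_continuous:
  assumes "firmly_nonexpansive T"
  shows "continuous_on UNIV T"
proof (rule lipschitz_on_continuous_on)
  show "1-lipschitz_on UNIV T"
    using firmly_nonexpansive_imp_nonexpansive[OF assms] by (auto intro!: lipschitz_onI simp: dist_norm)
qed

lemma firmly_nonexpansive_Fejer:
  assumes "firmly_nonexpansive T" "T y = y"
  shows "(norm (T z - y))\<^sup>2 + (norm (z - T z))\<^sup>2 \<le> (norm (z - y))\<^sup>2"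
proof -
  have "(norm (T z - y))\<^sup>2 \<le> (T z - y) \<bullet> (z - y)"
    using assms unfolding firmly_nonexpansive_def by metis
  then show ?thesis
    by (simp only: power2_norm_eq_inner) (simp add: inner_simps inner_commute)
qed

text \<open>With the increments \<open>a\<close>, \<open>b\<close>, \<open>d\<close> of the proof,
  \<open>(norm (d + b - a))\<^sup>2 - (d + b - a) \<bullet> d\<close> is exactly the sum of
  \<open>(norm a)\<^sup>2 - a \<bullet> d\<close> and
  \<open>(norm b)\<^sup>2 - b \<bullet> (2 *\<^sub>R a - d)\<close>, both of which are
  nonpositive.\<close>

lemma firmly_nonexpansive_Douglas_Rachford:
  assumes P: "firmly_nonexpansive P" and Q: "firmly_nonexpansive Q"
  shows "firmly_nonexpansive (\<lambda>z. z + Q (2 *\<^sub>R P z - z) - P z)"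
  unfolding firmly_nonexpansive_def
proof (intro allI)
  fix y z
  define a b d where "a = P z - P y" and "b = Q (2 *\<^sub>R P z - z) - Q (2 *\<^sub>R P y - y)" and "d = z - y"
  have "(norm a)\<^sup>2 \<le> a \<bullet> d" using P by (simp add: firmly_nonexpansive_def a_def d_def)
  moreover have "(norm b)\<^sup>2 \<le> b \<bullet> (2 *\<^sub>R a - d)"
    using Q[unfolded firmly_nonexpansive_def, rule_format, of "2 *\<^sub>R P z - z" "2 *\<^sub>R P y - y"]
    by (simp add: b_def a_def d_def algebra_simps)
  ultimately have "(norm (d + b - a))\<^sup>2 \<le> (d + b - a) \<bullet> d"
    by (simp only: power2_norm_eq_inner) (simp add: inner_simps inner_commute)
  moreover have "d + b - a = z + Q (2 *\<^sub>R P z - z) - P z - (y + Q (2 *\<^sub>R P y - y) - P y)"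
    by (simp add: a_def b_def d_def)
  ultimately show "(norm (z + Q (2 *\<^sub>R P z - z) - P z - (y + Q (2 *\<^sub>R P y - y) - P y)))\<^sup>2
      \<le> (z + Q (2 *\<^sub>R P z - z) - P z - (y + Q (2 *\<^sub>R P y - y) - P y)) \<bullet> (z - y)"
    by (simp only: d_def)
qed

text \<open>The strict epigraph of \<open>f\<close> and the strict hypograph of \<open>- g\<close>, shifted to the minimum,
  are disjoint; a separating hyperplane is not vertical and its slope is the subgradient.\<close>

lemma ex_subgradient_split_minimizer:
  fixes f g :: "'a::euclidean_space \<Rightarrow> real"
  assumes f: "convex_on UNIV f" and g: "convex_on UNIV g"
    and min: "\<And>u. f p + g p \<le> f u + g u"
  shows "\<exists>s. subgradient f p s \<and> subgradient g p (- s)"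
proof -
  define A where "A = {(u, r). f u - f p < r}"
  define C where "C = {(u, r). r < g p - g u}"
  have A: "convex A"
  proof (rule convexI)
    fix x y and a b :: real
    assume xy: "x \<in> A" "y \<in> A" and ab: "0 \<le> a" "0 \<le> b" "a + b = 1"
    have "f (a *\<^sub>R fst x + b *\<^sub>R fst y) \<le> a * f (fst x) + b * f (fst y)"
      using f ab unfolding convex_on_def by auto
    also have "\<dots> < a * (snd x + f p) + b * (snd y + f p)"
    \<comment> \<open>Multiplication by zero destroys strictness: it comes from the
      \<open>a\<close>-term unless \<open>a = 0\<close>, and then \<open>b = 1\<close> supplies
      it.\<close>
    proof (cases "a = 0")
      case False
      have "a * f (fst x) < a * (snd x + f p)" "b * f (fst y) \<le> b * (snd y + f p)"
        using xy ab False by (auto simp: A_def split: prod.splits intro!: mult_left_mono)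
      then show ?thesis by linarith
    qed (use xy ab in \<open>auto simp: A_def split: prod.splits\<close>)
    also have "\<dots> = a * snd x + b * snd y + (a + b) * f p" by (simp add: algebra_simps)
    finally show "a *\<^sub>R x + b *\<^sub>R y \<in> A" using ab(3) by (simp add: A_def case_prod_beta)
  qed
  have C: "convex C"
  proof (rule convexI)
    fix x y and a b :: real
    assume xy: "x \<in> C" "y \<in> C" and ab: "0 \<le> a" "0 \<le> b" "a + b = 1"
    have "g (a *\<^sub>R fst x + b *\<^sub>R fst y) \<le> a * g (fst x) + b * g (fst y)"
      using g ab unfolding convex_on_def by auto
    also have "\<dots> < a * (g p - snd x) + b * (g p - snd y)"
    proof (cases "a = 0")
      case False
      have "a * g (fst x) < a * (g p - snd x)" "b * g (fst y) \<le> b * (g p - snd y)"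
        using xy ab False by (auto simp: C_def split: prod.splits intro!: mult_left_mono)
      then show ?thesis by linarith
    qed (use xy ab in \<open>auto simp: C_def split: prod.splits\<close>)
    also have "\<dots> = (a + b) * g p - (a * snd x + b * snd y)" by (simp add: algebra_simps)
    finally show "a *\<^sub>R x + b *\<^sub>R y \<in> C" using ab(3) by (simp add: C_def case_prod_beta)
  qed
  have "A \<inter> C = {}"
  proof -
    have False if "f u - f p < r" "r < g p - g u" for u r using min[of u] that by linarith
    then show ?thesis by (auto simp: A_def C_def)
  qed
  moreover have "(p, 1) \<in> A" "(p, -1) \<in> C" by (auto simp: A_def C_def)
  ultimately obtain q d where q: "q \<noteq> 0" and qA: "\<forall>x\<in>A. q \<bullet> x \<le> d" and qC: "\<forall>x\<in>C. d \<le> q \<bullet> x"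
    using separating_hyperplane_sets[OF A C] by blast
  obtain a b where q_eq: "q = (a, b)" by (cases q)
  have sep: "a \<bullet> u + b * r \<le> a \<bullet> u' + b * r'" if "f u - f p < r" "r' < g p - g u'" for u u' r r'
    using qA[rule_format, of "(u, r)"] qC[rule_format, of "(u', r')"] that
    by (auto simp: A_def C_def q_eq)
  \<comment> \<open>The points above and below \<open>p\<close> fix the sign of the vertical
    component. With \<open>b = 0\<close> the separation would give
    \<open>a \<bullet> u \<le> a \<bullet> u'\<close> for all \<open>u\<close> and
    \<open>u'\<close>, forcing \<open>a = 0\<close>.\<close>
  have "b \<le> 0" using sep[of p 1 "-1" p] by simp
  moreover have "b \<noteq> 0"
  proof
    assume "b = 0"
    then have "a \<bullet> a \<le> a \<bullet> 0"
      using sep[of a "f a - f p + 1" "g p - g 0 - 1" 0] by simp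
    then have "a = 0" by (metis inner_gt_zero_iff inner_zero_right not_less)
    then show False using q \<open>b = 0\<close> by (simp add: q_eq zero_prod_def)
  qed
  ultimately have b: "b < 0" by simp
  define s where "s = (- 1 / b) *\<^sub>R a"
  have a: "a = (- b) *\<^sub>R s" using b by (simp add: s_def)
  \<comment> \<open>The two sets are strict, so the heights \<open>f u - f p\<close> and
    \<open>g p - g u'\<close> are reached only in the limit: each is missed by \<open>e / 2\<close>,
    and \<open>e\<close> is arbitrary. Setting \<open>u' = p\<close> and then \<open>u = p\<close>
    gives the two subgradient inequalities.\<close>
  have *: "s \<bullet> u - (f u - f p) \<le> s \<bullet> u' - (g p - g u')" for u u'
  proof (rule field_le_epsilon)
    fix e :: real assume "e > 0"
    then have "a \<bullet> u + b * (f u - f p + e / 2) \<le> a \<bullet> u' + b * (g p - g u' - e / 2)"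
      by (intro sep) auto
    then have "(- b) * (s \<bullet> u - (f u - f p + e / 2)) \<le> (- b) * (s \<bullet> u' - (g p - g u' - e / 2))"
      by (simp add: a algebra_simps)
    then show "s \<bullet> u - (f u - f p) \<le> s \<bullet> u' - (g p - g u') + e"
      using b by (subst (asm) mult_le_cancel_left_pos) auto
  qed
  have "subgradient f p s" using *[of _ p] by (force simp: subgradient_def inner_simps algebra_simps)
  moreover have "subgradient g p (- s)" using *[of p] by (force simp: subgradient_def inner_simps algebra_simps)
  ultimately show ?thesis by blast
qed

section \<open>Quasi-Fejer convergence of inexact iterations\<close>

text \<open>Subtracting the partial sums of the errors leaves a decreasing sequence, bounded below
  because \<open>a\<close> is nonnegative and the partial sums are bounded.\<close>

lemma quasi_decreasing_convergent:
  fixes a e :: "nat \<Rightarrow> real"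
  assumes a: "\<And>k. 0 \<le> a k" and e: "summable e" and step: "\<And>k. a (Suc k) \<le> a k + e k"
  shows "convergent a"
proof -
  define b where "b k = a k - (\<Sum>i<k. e i)" for k
  have conv: "(\<lambda>k. \<Sum>i<k. e i) \<longlonglongrightarrow> suminf e" using summable_LIMSEQ[OF e] .
  then obtain C where C: "\<And>k. \<bar>\<Sum>i<k. e i\<bar> \<le> C"
    using convergent_imp_Bseq[OF convergentI, of "\<lambda>k. \<Sum>i<k. e i"] by (auto simp: Bseq_def)
  have "decseq b" by (rule decseq_SucI) (use step in \<open>auto simp: b_def algebra_simps\<close>)
  moreover have "- C \<le> b k" for k using a[of k] C[of k] by (simp add: b_def)
  ultimately obtain l where "b \<longlonglongrightarrow> l" using decseq_convergent by metis
  then have "(\<lambda>k. b k + (\<Sum>i<k. e i)) \<longlonglongrightarrow> l + suminf e" using conv by (rule tendsto_add)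
  then show ?thesis by (auto simp: b_def convergent_def)
qed

text \<open>An Opial-type argument. The distances to each fixed point converge because the errors
  are summable; the Fejer inequality then forces the residual \<open>z k - T (z k)\<close> to zero,
  so every cluster point is fixed. The distance to one cluster point converges and vanishes along a
  subsequence, hence tends to zero.\<close>

lemma inexact_fixed_point_iteration_converges:
  fixes T :: "'a::euclidean_space \<Rightarrow> 'a"
  assumes T: "firmly_nonexpansive T" and fixp: "T y = y"
    and err: "summable (\<lambda>k. norm (z (Suc k) - T (z k)))"
  shows "\<exists>l. T l = l \<and> z \<longlonglongrightarrow> l"
proof -
  define e where "e k = norm (z (Suc k) - T (z k))" for k
  have e0: "e \<longlonglongrightarrow> 0" using summable_LIMSEQ_zero[OF err] by (simp add: e_def[abs_def])
  have conv: "convergent (\<lambda>k. norm (z k - q))" if q: "T q = q" for q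
  proof (rule quasi_decreasing_convergent)
    fix k
    have "norm (T (z k) - q) \<le> norm (z k - q)"
      using firmly_nonexpansive_imp_nonexpansive[OF T, of "z k" q] q by simp
    then show "norm (z (Suc k) - q) \<le> norm (z k - q) + e k"
      using norm_triangle_ineq[of "z (Suc k) - T (z k)" "T (z k) - q"] by (simp add: e_def)
  qed (use err in \<open>auto simp: e_def\<close>)
  obtain r where r: "(\<lambda>k. norm (z k - y)) \<longlonglongrightarrow> r" using conv[OF fixp] by (auto simp: convergent_def)
  have res: "(\<lambda>k. norm (z k - T (z k))) \<longlonglongrightarrow> 0"
  proof -
    have "(\<lambda>k. (norm (z k - T (z k)))\<^sup>2) \<longlonglongrightarrow> 0"
    proof (rule tendsto_sandwich[where f = "\<lambda>_. 0"])
      \<comment> \<open>The number \<open>norm (z (Suc k) - y) - e k\<close> may be negative, where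
        squaring is not monotone. The signed square \<open>s * \<bar>s\<bar>\<close> is monotone and
        has the same limit, as \<open>r\<close> is nonnegative.\<close>
      show "eventually (\<lambda>k. (norm (z k - T (z k)))\<^sup>2 \<le>
          (norm (z k - y))\<^sup>2 - (norm (z (Suc k) - y) - e k) * \<bar>norm (z (Suc k) - y) - e k\<bar>) sequentially"
      proof (rule always_eventually, rule allI)
        fix k
        have "norm (z (Suc k) - y) - e k \<le> norm (T (z k) - y)"
          using norm_triangle_ineq[of "z (Suc k) - T (z k)" "T (z k) - y"] by (simp add: e_def)
        then have "(norm (z (Suc k) - y) - e k) * \<bar>norm (z (Suc k) - y) - e k\<bar> \<le> (norm (T (z k) - y))\<^sup>2"
          by (cases "0 \<le> norm (z (Suc k) - y) - e k")
            (simp_all add: power2_eq_square mult_mono order_trans[OF mult_nonpos_nonneg zero_le_square])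
        then show "(norm (z k - T (z k)))\<^sup>2 \<le>
          (norm (z k - y))\<^sup>2 - (norm (z (Suc k) - y) - e k) * \<bar>norm (z (Suc k) - y) - e k\<bar>"
          using firmly_nonexpansive_Fejer[OF T fixp, of "z k"] by linarith
      qed
      have "0 \<le> r" using LIMSEQ_le_const[OF r] by auto
      moreover have "(\<lambda>k. (norm (z k - y))\<^sup>2 - (norm (z (Suc k) - y) - e k) * \<bar>norm (z (Suc k) - y) - e k\<bar>)
          \<longlonglongrightarrow> r\<^sup>2 - (r - 0) * \<bar>r - 0\<bar>"
        by (intro tendsto_intros r e0 LIMSEQ_Suc[OF r])
      ultimately show "(\<lambda>k. (norm (z k - y))\<^sup>2 - (norm (z (Suc k) - y) - e k) * \<bar>norm (z (Suc k) - y) - e k\<bar>)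
          \<longlonglongrightarrow> 0" by (simp add: power2_eq_square)
    qed auto
    then have "(\<lambda>k. sqrt ((norm (z k - T (z k)))\<^sup>2)) \<longlonglongrightarrow> sqrt 0" by (intro tendsto_intros)
    then show ?thesis by simp
  qed
  obtain C where C: "\<And>k. norm (z k - y) \<le> C"
    using convergent_imp_Bseq[OF conv[OF fixp]] by (auto simp: Bseq_def)
  have "bounded (range z)"
    unfolding bounded_def by (rule exI[of _ y], rule exI[of _ C]) (use C in \<open>auto simp: dist_norm norm_minus_commute\<close>)
  then obtain l \<sigma> where l: "strict_mono \<sigma>" "(z \<circ> \<sigma>) \<longlonglongrightarrow> l"
    using bounded_imp_convergent_subsequence by metis
  have "isCont T l" using firmly_nonexpansive_imp_continuous[OF T]
    by (simp add: continuous_on_eq_continuous_at)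
  then have "(\<lambda>k. (z \<circ> \<sigma>) k - T ((z \<circ> \<sigma>) k)) \<longlonglongrightarrow> l - T l"
    by (intro tendsto_intros l isCont_tendsto_compose[of l T])
  moreover have "(\<lambda>k. (z \<circ> \<sigma>) k - T ((z \<circ> \<sigma>) k)) \<longlonglongrightarrow> 0"
    using LIMSEQ_subseq_LIMSEQ[OF res l(1)] by - (rule tendsto_norm_zero_cancel, simp add: o_def)
  ultimately have fl: "T l = l" using LIMSEQ_unique by force
  obtain r' where r': "(\<lambda>k. norm (z k - l)) \<longlonglongrightarrow> r'" using conv[OF fl] by (auto simp: convergent_def)
  have "(\<lambda>k. norm ((z \<circ> \<sigma>) k - l)) \<longlonglongrightarrow> norm (l - l)" by (intro tendsto_intros l)
  moreover have "(\<lambda>k. norm ((z \<circ> \<sigma>) k - l)) \<longlonglongrightarrow> r'"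
    using LIMSEQ_subseq_LIMSEQ[OF r' l(1)] by (simp add: o_def)
  ultimately have "r' = 0" using LIMSEQ_unique by force
  then have "z \<longlonglongrightarrow> l" using r' by (simp add: LIM_zero_cancel tendsto_norm_zero_iff)
  then show ?thesis using fl by blast
qed

text \<open>The errors of the two resolvents are errors of the exact operator \<open>T\<close>. At
  the limit \<open>l\<close> of \<open>z\<close>, the point \<open>prox t f l\<close> is optimal
  because the fixed-point equation makes the subgradients of \<open>f\<close> and \<open>g\<close>
  there opposite to each other.\<close>

lemma inexact_Douglas_Rachford_converges:
  fixes f g :: "'a::euclidean_space \<Rightarrow> real"
  assumes f: "convex_on UNIV f" "lipschitz_on L UNIV f" and g: "convex_on UNIV g" "lipschitz_on L UNIV g"
    and t: "t > 0" and min: "\<And>u. f q + g q \<le> f u + g u"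
    and err1: "summable (\<lambda>k. norm (xh k - prox t f (z k)))"
    and err2: "summable (\<lambda>k. norm (x (Suc k) - prox t g (2 *\<^sub>R xh k - z k)))"
    and step: "\<And>k. z (Suc k) = z k + x (Suc k) - xh k"
  shows "\<exists>p. (\<forall>u. f p + g p \<le> f u + g u) \<and> x \<longlonglongrightarrow> p"
proof -
  define P Q where "P = prox t f" and "Q = prox t g"
  have PQ: "firmly_nonexpansive P" "firmly_nonexpansive Q"
    unfolding P_def Q_def by (intro firmly_nonexpansive_prox[OF f t] firmly_nonexpansive_prox[OF g t])+
  define T where "T z = z + Q (2 *\<^sub>R P z - z) - P z" for z
  have T: "firmly_nonexpansive T"
    using firmly_nonexpansive_Douglas_Rachford[OF PQ] by (simp add: T_def[abs_def])
  obtain s where s: "subgradient f q s" "subgradient g q (- s)"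
    using ex_subgradient_split_minimizer[OF f(1) g(1) min] by blast
  \<comment> \<open>The resolvent of \<open>f\<close> sends \<open>q + t *\<^sub>R s\<close> to
    \<open>q\<close>; reflection gives \<open>q - t *\<^sub>R s\<close>, which the resolvent of
    \<open>g\<close> sends to \<open>q\<close> again.\<close>
  have "P (q + t *\<^sub>R s) = q" unfolding P_def by (rule prox_eqI[OF f t]) (use s t in auto)
  moreover have "Q (2 *\<^sub>R q - (q + t *\<^sub>R s)) = q"
    unfolding Q_def by (rule prox_eqI[OF g t]) (use s t in \<open>auto simp: algebra_simps scaleR_2\<close>)
  ultimately have fixp: "T (q + t *\<^sub>R s) = q + t *\<^sub>R s" by (simp add: T_def)
  have "summable (\<lambda>k. norm (z (Suc k) - T (z k)))"
  proof (rule summable_comparison_test'[where N = 0])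
    \<comment> \<open>The error of \<open>xh k\<close> counts three times: once in the update of
      \<open>z\<close>, and twice in the argument \<open>2 *\<^sub>R xh k - z k\<close> of the
      nonexpansive map \<open>Q\<close>.\<close>
    show "summable (\<lambda>k. norm (x (Suc k) - Q (2 *\<^sub>R xh k - z k)) + 3 * norm (xh k - P (z k)))"
      unfolding P_def Q_def by (intro summable_add summable_mult err1 err2)
    fix k
    have le: "norm (Q (2 *\<^sub>R xh k - z k) - Q (2 *\<^sub>R P (z k) - z k)) \<le> norm (2 *\<^sub>R (xh k - P (z k)))"
      using firmly_nonexpansive_imp_nonexpansive[OF PQ(2), of "2 *\<^sub>R xh k - z k" "2 *\<^sub>R P (z k) - z k"]
      by (simp add: algebra_simps)
    have eq: "z (Suc k) - T (z k) = (x (Suc k) - Q (2 *\<^sub>R xh k - z k))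
        + (Q (2 *\<^sub>R xh k - z k) - Q (2 *\<^sub>R P (z k) - z k)) - (xh k - P (z k))"
      by (simp add: step T_def)
    note le
    moreover have "norm (z (Suc k) - T (z k)) \<le> norm (x (Suc k) - Q (2 *\<^sub>R xh k - z k))
        + norm (Q (2 *\<^sub>R xh k - z k) - Q (2 *\<^sub>R P (z k) - z k)) + norm (xh k - P (z k))"
      unfolding eq by (rule norm_triangle_le_diff, rule add_right_mono, rule norm_triangle_ineq)
    ultimately show "norm (norm (z (Suc k) - T (z k)))
        \<le> norm (x (Suc k) - Q (2 *\<^sub>R xh k - z k)) + 3 * norm (xh k - P (z k))"
      by simp
  qed
  then obtain l where l: "T l = l" "z \<longlonglongrightarrow> l"
    using inexact_fixed_point_iteration_converges[OF T fixp] by blast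
  have "isCont P l" using firmly_nonexpansive_imp_continuous[OF PQ(1)]
    by (simp add: continuous_on_eq_continuous_at)
  then have "(\<lambda>k. P (z k)) \<longlonglongrightarrow> P l" using l(2) by (rule isCont_tendsto_compose)
  moreover have "(\<lambda>k. xh k - P (z k)) \<longlonglongrightarrow> 0"
    using summable_LIMSEQ_zero[OF err1] by - (rule tendsto_norm_zero_cancel, simp add: P_def)
  \<comment> \<open>By the update rule this sum is \<open>x (Suc k)\<close>; consecutive
    \<open>z\<close> differ by a null sequence, so \<open>x\<close> follows
    \<open>P (z k)\<close>.\<close>
  ultimately have "(\<lambda>k. z (Suc k) - z k + (P (z k) + (xh k - P (z k)))) \<longlonglongrightarrow> l - l + (P l + 0)"
    by (intro tendsto_intros LIMSEQ_Suc[OF l(2)] l(2)) assumption+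
  then have "x \<longlonglongrightarrow> P l" by - (rule LIMSEQ_imp_Suc, simp add: step)
  moreover have "f (P l) + g (P l) \<le> f u + g u" for u
  proof -
    have "subgradient f (P l) ((l - P l) /\<^sub>R t)" unfolding P_def by (rule subgradient_prox[OF f t])
    then have 1: "f (P l) + ((l - P l) /\<^sub>R t) \<bullet> (u - P l) \<le> f u" by (rule subgradientD)
    have Ql: "Q (2 *\<^sub>R P l - l) = P l" using l(1) by (simp add: T_def)
    have "subgradient g (Q (2 *\<^sub>R P l - l)) ((2 *\<^sub>R P l - l - Q (2 *\<^sub>R P l - l)) /\<^sub>R t)"
      unfolding Q_def by (rule subgradient_prox[OF g t])
    moreover have "2 *\<^sub>R P l - l - P l = - (l - P l)" by (simp add: scaleR_2)
    ultimately have "subgradient g (P l) (- ((l - P l) /\<^sub>R t))" unfolding Ql by (metis scaleR_minus_right)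
    then have 2: "g (P l) + (- ((l - P l) /\<^sub>R t)) \<bullet> (u - P l) \<le> g u" by (rule subgradientD)
    show ?thesis using 1 2 by (simp only: inner_minus_left)
  qed
  ultimately show ?thesis by blast
qed

subsection \<open>Self-normalized averages of independent samples\<close>

text \<open>The variance of a sum of independent centred variables: the mixed terms of the expanded
  square integrate to zero.\<close>

lemma PiM_centered_sum_square:
  fixes h :: "'a \<Rightarrow> real"
  assumes \<gamma>: "prob_space \<gamma>" and I: "finite I"
    and meas: "h \<in> borel_measurable \<gamma>" and sq: "integrable \<gamma> (\<lambda>y. (h y)\<^sup>2)"
    and zero: "(\<integral>y. h y \<partial>\<gamma>) = 0"
  shows "integrable (PiM I (\<lambda>_. \<gamma>)) (\<lambda>x. (\<Sum>i\<in>I. h (x i))\<^sup>2)"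
    and "(\<integral>x. (\<Sum>i\<in>I. h (x i))\<^sup>2 \<partial>PiM I (\<lambda>_. \<gamma>)) = real (card I) * (\<integral>y. (h y)\<^sup>2 \<partial>\<gamma>)"
proof -
  interpret \<gamma>: prob_space \<gamma> by fact
  interpret P: product_sigma_finite "\<lambda>_. \<gamma>" by standard
  have int: "integrable \<gamma> h" using \<gamma>.square_integrable_imp_integrable[OF meas sq] .
  \<comment> \<open>One factor per coordinate \<open>k\<close>, with product
    \<open>h (x i) * h (x j)\<close>. For \<open>i = j\<close> the factor at \<open>i\<close>
    becomes the square, so integration over the product space treats the diagonal and the mixed
    terms alike.\<close>
  define \<phi> where "\<phi> i j k y = (if k = i then h y else 1) * (if k = j then h y else 1)" for i j k :: 'b and y
  have \<phi>_int: "integrable \<gamma> (\<phi> i j k)" for i j k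
  proof -
    have "\<phi> i j k = (if k = i then if k = j then (\<lambda>y. (h y)\<^sup>2) else h else if k = j then h else (\<lambda>_. 1))"
      by (auto simp: \<phi>_def power2_eq_square)
    then show ?thesis using int sq by simp
  qed
  have \<phi>_prod: "(\<Prod>k\<in>I. \<phi> i j k (x k)) = h (x i) * h (x j)" if "i \<in> I" "j \<in> I" for i j x
    unfolding \<phi>_def prod.distrib using that I by (simp add: prod.delta')
  have intP: "integrable (PiM I (\<lambda>_. \<gamma>)) (\<lambda>x. h (x i) * h (x j))" if "i \<in> I" "j \<in> I" for i j
    using P.product_integrable_prod[OF I, where f = "\<phi> i j", OF \<phi>_int] by (simp add: \<phi>_prod that)
  have E: "(\<integral>x. h (x i) * h (x j) \<partial>PiM I (\<lambda>_. \<gamma>)) = (if i = j then (\<integral>y. (h y)\<^sup>2 \<partial>\<gamma>) else 0)"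
    if ij: "i \<in> I" "j \<in> I" for i j
  proof -
    have "(\<integral>x. h (x i) * h (x j) \<partial>PiM I (\<lambda>_. \<gamma>)) = (\<Prod>k\<in>I. integral\<^sup>L \<gamma> (\<phi> i j k))"
      using P.product_integral_prod[OF I, where f = "\<phi> i j", OF \<phi>_int] by (simp add: \<phi>_prod ij)
    also have "\<dots> = (if i = j then (\<integral>y. (h y)\<^sup>2 \<partial>\<gamma>) else 0)"
    proof (cases "i = j")
      case True
      have "integral\<^sup>L \<gamma> (\<phi> j j k) = (if k = j then (\<integral>y. (h y)\<^sup>2 \<partial>\<gamma>) else 1)" for k
        by (auto simp: \<phi>_def[abs_def] power2_eq_square \<gamma>.prob_space)
      then show ?thesis using True ij I by simp
    next
      case False
      then have "integral\<^sup>L \<gamma> (\<phi> i j i) = 0" by (simp add: \<phi>_def[abs_def] zero)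
      then show ?thesis using False ij I by (auto simp: prod_zero_iff)
    qed
    finally show ?thesis .
  qed
  have eq: "(\<Sum>i\<in>I. h (x i))\<^sup>2 = (\<Sum>i\<in>I. \<Sum>j\<in>I. h (x i) * h (x j))" for x
    by (simp add: power2_eq_square sum_product)
  show "integrable (PiM I (\<lambda>_. \<gamma>)) (\<lambda>x. (\<Sum>i\<in>I. h (x i))\<^sup>2)"
    unfolding eq by (intro Bochner_Integration.integrable_sum intP)
  show "(\<integral>x. (\<Sum>i\<in>I. h (x i))\<^sup>2 \<partial>PiM I (\<lambda>_. \<gamma>)) = real (card I) * (\<integral>y. (h y)\<^sup>2 \<partial>\<gamma>)"
    unfolding eq using I by (simp add: Bochner_Integration.integral_sum intP E)
qed

lemma (in prob_space) integrable_if_norm_square_integrable: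
  fixes h :: "'a \<Rightarrow> 'b::euclidean_space"
  assumes "h \<in> borel_measurable M" "integrable M (\<lambda>y. (norm (h y))\<^sup>2)"
  shows "integrable M h"
  using square_integrable_imp_integrable[of "\<lambda>y. norm (h y)"] assms
  by (auto intro: integrable_norm_cancel)

text \<open>Reduction to the scalar case along an orthonormal basis. Dropping the squared mean from
  each variance turns the identity into a bound by the raw second moment.\<close>

lemma PiM_norm_centered_sum_square:
  fixes h :: "'a \<Rightarrow> 'b::euclidean_space"
  assumes \<gamma>: "prob_space \<gamma>" and I: "finite I"
    and meas: "h \<in> borel_measurable \<gamma>" and sq: "integrable \<gamma> (\<lambda>y. (norm (h y))\<^sup>2)"
  defines "\<mu> \<equiv> \<integral>y. h y \<partial>\<gamma>"
  shows "integrable (PiM I (\<lambda>_. \<gamma>)) (\<lambda>x. (norm (\<Sum>i\<in>I. h (x i) - \<mu>))\<^sup>2)"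
    and "(\<integral>x. (norm (\<Sum>i\<in>I. h (x i) - \<mu>))\<^sup>2 \<partial>PiM I (\<lambda>_. \<gamma>))
      \<le> real (card I) * (\<integral>y. (norm (h y))\<^sup>2 \<partial>\<gamma>)"
proof -
  interpret \<gamma>: prob_space \<gamma> by fact
  note [measurable] = meas
  have int: "integrable \<gamma> h" using \<gamma>.integrable_if_norm_square_integrable[OF meas sq] .
  define q where "q b y = (h y - \<mu>) \<bullet> b" for b y
  have q_meas: "q b \<in> borel_measurable \<gamma>" for b unfolding q_def by measurable
  have hb_sq: "integrable \<gamma> (\<lambda>y. (h y \<bullet> b)\<^sup>2)" if "b \<in> Basis" for b
    by (rule Bochner_Integration.integrable_bound[OF sq])
      (use that in \<open>auto simp: Basis_le_norm power_mono abs_le_square_iff[symmetric] intro!: AE_I2\<close>)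
  have hb: "integrable \<gamma> (\<lambda>y. h y \<bullet> b)" for b using int by simp
  have mb: "(\<integral>y. h y \<bullet> b \<partial>\<gamma>) = \<mu> \<bullet> b" for b unfolding \<mu>_def using int by simp
  have q_eq: "(q b y)\<^sup>2 = (h y \<bullet> b)\<^sup>2 - 2 * (\<mu> \<bullet> b) * (h y \<bullet> b) + (\<mu> \<bullet> b)\<^sup>2" for b y
    by (simp add: q_def inner_diff_left power2_diff)
  have q_sq: "integrable \<gamma> (\<lambda>y. (q b y)\<^sup>2)" if "b \<in> Basis" for b
    unfolding q_eq using hb_sq[OF that] hb by simp
  have q_le: "(\<integral>y. (q b y)\<^sup>2 \<partial>\<gamma>) \<le> (\<integral>y. (h y \<bullet> b)\<^sup>2 \<partial>\<gamma>)" if "b \<in> Basis" for b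
    unfolding q_eq using hb_sq[OF that] hb by (simp add: mb \<gamma>.prob_space power2_eq_square)
  have q0: "(\<integral>y. q b y \<partial>\<gamma>) = 0" for b
    unfolding q_def inner_diff_left using hb by (simp add: mb \<gamma>.prob_space)
  have norm_sq: "(norm y)\<^sup>2 = (\<Sum>b\<in>Basis. (y \<bullet> b)\<^sup>2)" for y :: 'b
    unfolding power2_norm_eq_inner euclidean_inner[of y y] by (simp only: power2_eq_square)
  have norm_eq: "(norm (\<Sum>i\<in>I. h (x i) - \<mu>))\<^sup>2 = (\<Sum>b\<in>Basis. (\<Sum>i\<in>I. q b (x i))\<^sup>2)" for x
    by (simp only: norm_sq q_def inner_sum_left)
  note sq_b = PiM_centered_sum_square[OF \<gamma> I q_meas q_sq q0]
  show "integrable (PiM I (\<lambda>_. \<gamma>)) (\<lambda>x. (norm (\<Sum>i\<in>I. h (x i) - \<mu>))\<^sup>2)"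
    unfolding norm_eq by (intro Bochner_Integration.integrable_sum sq_b)
  have "(\<integral>x. (norm (\<Sum>i\<in>I. h (x i) - \<mu>))\<^sup>2 \<partial>PiM I (\<lambda>_. \<gamma>))
      = real (card I) * (\<Sum>b\<in>Basis. \<integral>y. (q b y)\<^sup>2 \<partial>\<gamma>)"
    unfolding norm_eq by (simp add: Bochner_Integration.integral_sum sq_b sum_distrib_left)
  also have "\<dots> \<le> real (card I) * (\<Sum>b\<in>Basis. \<integral>y. (h y \<bullet> b)\<^sup>2 \<partial>\<gamma>)"
    by (intro mult_left_mono sum_mono q_le) auto
  also have "(\<Sum>b\<in>Basis. \<integral>y. (h y \<bullet> b)\<^sup>2 \<partial>\<gamma>) = (\<integral>y. (norm (h y))\<^sup>2 \<partial>\<gamma>)"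
    by (simp add: norm_sq hb_sq)
  finally show "(\<integral>x. (norm (\<Sum>i\<in>I. h (x i) - \<mu>))\<^sup>2 \<partial>PiM I (\<lambda>_. \<gamma>))
      \<le> real (card I) * (\<integral>y. (norm (h y))\<^sup>2 \<partial>\<gamma>)" .
qed

lemma PiM_Chebyshev:
  fixes h :: "'a \<Rightarrow> 'b::euclidean_space"
  assumes \<gamma>: "prob_space \<gamma>" and I: "finite I" "I \<noteq> {}"
    and meas: "h \<in> borel_measurable \<gamma>" and sq: "integrable \<gamma> (\<lambda>y. (norm (h y))\<^sup>2)" and r: "r > 0"
  defines "\<mu> \<equiv> \<integral>y. h y \<partial>\<gamma>"
  shows "measure (PiM I (\<lambda>_. \<gamma>)) {x \<in> space (PiM I (\<lambda>_. \<gamma>)). real (card I) * r \<le> norm (\<Sum>i\<in>I. h (x i) - \<mu>)}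
    \<le> (\<integral>y. (norm (h y))\<^sup>2 \<partial>\<gamma>) / (real (card I) * r\<^sup>2)"
proof -
  let ?P = "PiM I (\<lambda>_. \<gamma>)"
  define n where "n = real (card I)"
  have n: "n > 0" using I by (simp add: n_def card_gt_0_iff)
  note sum_sq = PiM_norm_centered_sum_square[OF \<gamma> I(1) meas sq, folded \<mu>_def]
  have "{x \<in> space ?P. n * r \<le> norm (\<Sum>i\<in>I. h (x i) - \<mu>)}
      = {x \<in> space ?P. (norm (\<Sum>i\<in>I. h (x i) - \<mu>))\<^sup>2 \<ge> (n * r)\<^sup>2}"
    using n r by (auto simp: abs_le_square_iff[symmetric])
  also have "measure ?P \<dots> \<le> (\<integral>x. (norm (\<Sum>i\<in>I. h (x i) - \<mu>))\<^sup>2 \<partial>?P) / (n * r)\<^sup>2"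
    by (rule integral_Markov_inequality_measure[OF sum_sq(1) sets.empty_sets]) (use n r in auto)
  also have "\<dots> \<le> (n * (\<integral>y. (norm (h y))\<^sup>2 \<partial>\<gamma>)) / (n * r)\<^sup>2"
    by (rule divide_right_mono) (use sum_sq(2) in \<open>auto simp: n_def\<close>)
  also have "\<dots> = (\<integral>y. (norm (h y))\<^sup>2 \<partial>\<gamma>) / (n * r\<^sup>2)"
    using n r by (simp add: field_simps power2_eq_square)
  finally show ?thesis by (simp add: n_def)
qed

text \<open>Here \<open>d\<close> is the displacement from the target and \<open>b\<close> bounds
  the bias. With \<open>n = card I\<close>, outside two Chebyshev events the denominator exceeds
  half of its mean \<open>n * V\<close>, and the numerator has norm below
  \<open>n * (\<epsilon> + b) * V\<close>, so the quotient stays below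
  \<open>2 * \<epsilon> + 2 * b\<close>. Letting the denominator lose half of its mean causes both
  the factor 2 and the 4 in \<open>4 * R\<close>.\<close>

lemma self_normalized_average_concentration:
  fixes d :: "'a \<Rightarrow> 'b::euclidean_space" and w :: "'a \<Rightarrow> real"
  assumes \<gamma>: "prob_space \<gamma>" and I: "finite I" "I \<noteq> {}"
    and w [measurable]: "w \<in> borel_measurable \<gamma>" and d [measurable]: "d \<in> borel_measurable \<gamma>"
    and w_sq: "integrable \<gamma> (\<lambda>y. (w y)\<^sup>2)" and wd_sq: "integrable \<gamma> (\<lambda>y. (norm (w y *\<^sub>R d y))\<^sup>2)"
    and V: "V = (\<integral>y. w y \<partial>\<gamma>)" "V > 0"
    and w_le: "(\<integral>y. (w y)\<^sup>2 \<partial>\<gamma>) \<le> R * V\<^sup>2"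
    and wd_le: "(\<integral>y. (norm (w y *\<^sub>R d y))\<^sup>2 \<partial>\<gamma>) \<le> S * V\<^sup>2"
    and bias: "norm (\<integral>y. w y *\<^sub>R d y \<partial>\<gamma>) \<le> b * V"
    and \<epsilon>: "\<epsilon> > 0"
  shows "measure (PiM I (\<lambda>_. \<gamma>)) {x \<in> space (PiM I (\<lambda>_. \<gamma>)).
      2 * \<epsilon> + 2 * b < norm ((\<Sum>i\<in>I. w (x i) *\<^sub>R d (x i)) /\<^sub>R (\<Sum>i\<in>I. w (x i)))}
    \<le> 4 * R / real (card I) + S / (real (card I) * \<epsilon>\<^sup>2)"
proof -
  let ?P = "PiM I (\<lambda>_. \<gamma>)"
  interpret \<gamma>: prob_space \<gamma> by fact
  interpret P: prob_space ?P by (intro prob_space_PiM \<gamma>)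
  define n where "n = real (card I)"
  have n: "n > 0" using I by (simp add: n_def card_gt_0_iff)
  define \<mu> where "\<mu> = (\<integral>y. w y *\<^sub>R d y \<partial>\<gamma>)"
  define A where "A = {x \<in> space ?P. n * (V / 2) \<le> norm (\<Sum>i\<in>I. w (x i) - V)}"
  define C where "C = {x \<in> space ?P. n * (\<epsilon> * V) \<le> norm (\<Sum>i\<in>I. w (x i) *\<^sub>R d (x i) - \<mu>)}"
  have w_coord [measurable]: "(\<lambda>x. w (x i)) \<in> borel_measurable ?P" if "i \<in> I" for i using that by measurable
  have d_coord [measurable]: "(\<lambda>x. d (x i)) \<in> borel_measurable ?P" if "i \<in> I" for i using that by measurable
  have [measurable]: "A \<in> sets ?P" "C \<in> sets ?P" unfolding A_def C_def by measurable
  have "{x \<in> space ?P. 2 * \<epsilon> + 2 * b < norm ((\<Sum>i\<in>I. w (x i) *\<^sub>R d (x i)) /\<^sub>R (\<Sum>i\<in>I. w (x i)))} \<subseteq> A \<union> C"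
  proof (rule subsetI, rule ccontr)
    fix x assume x: "x \<in> {x \<in> space ?P. 2 * \<epsilon> + 2 * b < norm ((\<Sum>i\<in>I. w (x i) *\<^sub>R d (x i)) /\<^sub>R (\<Sum>i\<in>I. w (x i)))}"
      and "x \<notin> A \<union> C"
    then have "norm ((\<Sum>i\<in>I. w (x i)) - n * V) < n * (V / 2)"
      and "norm ((\<Sum>i\<in>I. w (x i) *\<^sub>R d (x i)) - n *\<^sub>R \<mu>) < n * (\<epsilon> * V)"
      by (auto simp: A_def C_def sum_subtractf n_def sum_constant_scaleR)
    then have lower: "n * V / 2 < (\<Sum>i\<in>I. w (x i))"
      and upper: "norm (\<Sum>i\<in>I. w (x i) *\<^sub>R d (x i)) < n * (\<epsilon> * V) + n * norm \<mu>"
      using norm_triangle_sub[of "\<Sum>i\<in>I. w (x i) *\<^sub>R d (x i)" "n *\<^sub>R \<mu>"] n by (auto simp: abs_if mult.commute[of V] split: if_splits)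
    have pos: "0 < n * V / 2" using n V by simp
    have "n * norm \<mu> \<le> n * (b * V)" using bias n by (simp add: \<mu>_def)
    then have "norm (\<Sum>i\<in>I. w (x i) *\<^sub>R d (x i)) < (2 * \<epsilon> + 2 * b) * (n * V / 2)"
      using upper by (simp add: algebra_simps)
    also have "\<dots> \<le> (2 * \<epsilon> + 2 * b) * (\<Sum>i\<in>I. w (x i))"
    proof (rule mult_left_mono)
      have "0 \<le> b * V" using order_trans[OF norm_ge_zero bias] .
      then show "0 \<le> 2 * \<epsilon> + 2 * b" using V \<epsilon> by (simp add: zero_le_mult_iff)
    qed (use lower in simp)
    finally have "norm ((\<Sum>i\<in>I. w (x i) *\<^sub>R d (x i)) /\<^sub>R (\<Sum>i\<in>I. w (x i))) < 2 * \<epsilon> + 2 * b"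
      using lower pos by (simp add: field_simps)
    then show False using x by simp
  qed
  then have "measure ?P {x \<in> space ?P. 2 * \<epsilon> + 2 * b < norm ((\<Sum>i\<in>I. w (x i) *\<^sub>R d (x i)) /\<^sub>R (\<Sum>i\<in>I. w (x i)))}
      \<le> measure ?P (A \<union> C)" by (intro P.finite_measure_mono) auto
  also have "\<dots> \<le> measure ?P A + measure ?P C" by (rule measure_Un_le) auto
  also have "measure ?P A \<le> (\<integral>y. (norm (w y))\<^sup>2 \<partial>\<gamma>) / (n * (V / 2)\<^sup>2)"
    unfolding A_def n_def V(1) by (rule PiM_Chebyshev[OF \<gamma> I]) (use V w_sq in auto)
  also have "\<dots> \<le> R * V\<^sup>2 / (n * (V / 2)\<^sup>2)"
    using w_le n by (intro divide_right_mono) auto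
  also have "\<dots> = 4 * R / n" using n V(2) by (simp add: field_simps power2_eq_square)
  also have "measure ?P C \<le> (\<integral>y. (norm (w y *\<^sub>R d y))\<^sup>2 \<partial>\<gamma>) / (n * (\<epsilon> * V)\<^sup>2)"
    unfolding C_def n_def \<mu>_def by (rule PiM_Chebyshev[OF \<gamma> I]) (use V wd_sq \<epsilon> in auto)
  also have "\<dots> \<le> S * V\<^sup>2 / (n * (\<epsilon> * V)\<^sup>2)"
    using wd_le n by (intro divide_right_mono) auto
  also have "\<dots> = S / (n * \<epsilon>\<^sup>2)" using n V(2) \<epsilon> by (simp add: field_simps power2_eq_square)
  finally show ?thesis by (simp add: n_def)
qed

subsection \<open>Gaussian integrals\<close>

lemma sets_isotropic_gaussian [simp, measurable_cong]: "sets (isotropic_gaussian m v) = sets borel"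
  by (simp add: isotropic_gaussian_def)

lemma space_isotropic_gaussian [simp]: "space (isotropic_gaussian m v) = UNIV"
  by (simp add: isotropic_gaussian_def)

text \<open>Translation invariance of Lebesgue measure; it lets all centres share one product of
  centred Gaussians.\<close>

lemma isotropic_gaussian_shift:
  "isotropic_gaussian m v = distr (isotropic_gaussian 0 v) borel (\<lambda>x. m + x)"
proof -
  have "isotropic_gaussian m v = density (distr lborel borel ((+) m))
      (\<lambda>z. ennreal (exp (- (norm (z - m))\<^sup>2 / (2 * v)) / sqrt (2 * pi * v) ^ CARD('a)))"
    by (simp add: isotropic_gaussian_def lborel_distr_plus)
  also have "\<dots> = distr (density lborel
      (\<lambda>z. ennreal (exp (- (norm (m + z - m))\<^sup>2 / (2 * v)) / sqrt (2 * pi * v) ^ CARD('a)))) borel ((+) m)"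
    by (rule density_distr) auto
  finally show ?thesis by (simp add: isotropic_gaussian_def)
qed

lemma prob_space_isotropic_gaussian:
  fixes m :: "real^'n"
  assumes v: "v > 0"
  shows "prob_space (isotropic_gaussian m v)"
proof -
  have "emeasure (isotropic_gaussian (0::real^'n) v) UNIV
      = (\<integral>\<^sup>+z. ennreal (exp (- (norm (z::real^'n))\<^sup>2 / (2 * v)) / sqrt (2 * pi * v) ^ CARD('n)) \<partial>lborel)"
    by (simp add: isotropic_gaussian_def emeasure_density)
  \<comment> \<open>The density factors over the coordinates; \<open>normal_density\<close> takes a
    standard deviation, hence \<open>sqrt v\<close>.\<close>
  also have "\<dots> = (\<integral>\<^sup>+z. (\<Prod>b\<in>Basis. ennreal (normal_density 0 (sqrt v) ((z::real^'n) \<bullet> b))) \<partial>lborel)"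
  proof (rule nn_integral_cong)
    fix z :: "real^'n"
    have "(norm z)\<^sup>2 = (\<Sum>b\<in>Basis. (z \<bullet> b)\<^sup>2)"
      unfolding power2_norm_eq_inner euclidean_inner[of z z] by (simp only: power2_eq_square)
    then have "exp (- (norm z)\<^sup>2 / (2 * v)) = (\<Prod>b\<in>Basis. exp (- (z \<bullet> b)\<^sup>2 / (2 * v)))"
      by (simp add: exp_sum[symmetric] sum_negf sum_divide_distrib)
    then have "exp (- (norm z)\<^sup>2 / (2 * v)) / sqrt (2 * pi * v) ^ CARD('n)
        = (\<Prod>b\<in>Basis. exp (- (z \<bullet> b)\<^sup>2 / (2 * v)) / sqrt (2 * pi * v))"
      by (simp add: prod_dividef)
    also have "\<dots> = (\<Prod>b\<in>Basis. normal_density 0 (sqrt v) (z \<bullet> b))"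
      using v by (simp add: normal_density_def)
    finally show "ennreal (exp (- (norm z)\<^sup>2 / (2 * v)) / sqrt (2 * pi * v) ^ CARD('n))
        = (\<Prod>b\<in>Basis. ennreal (normal_density 0 (sqrt v) (z \<bullet> b)))"
      by (simp add: prod_ennreal)
  qed
  also have "\<dots> = (\<Prod>b\<in>(Basis::(real^'n) set). \<integral>\<^sup>+x. ennreal (normal_density 0 (sqrt v) x) \<partial>lborel)"
    by (rule nn_integral_lborel_prod) auto
  also have "(\<integral>\<^sup>+x. ennreal (normal_density 0 (sqrt v) x) \<partial>lborel) = 1"
  proof -
    interpret N: prob_space "density lborel (normal_density 0 (sqrt v))"
      using v by (intro prob_space_normal_density) simp
    show ?thesis using N.emeasure_space_1 by (simp add: emeasure_density)
  qed
  finally have "prob_space (isotropic_gaussian (0::real^'n) v)" by (intro prob_spaceI) simp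
  then show ?thesis
    by (subst isotropic_gaussian_shift) (rule prob_space.prob_space_distr, auto)
qed

lemma nn_integral_isotropic_gaussian:
  fixes f :: "real^'n \<Rightarrow> ennreal"
  assumes [measurable]: "f \<in> borel_measurable borel"
  shows "(\<integral>\<^sup>+h. f h \<partial>isotropic_gaussian m v)
    = (\<integral>\<^sup>+h. ennreal (exp (- (norm (h - m))\<^sup>2 / (2 * v)) / sqrt (2 * pi * v) ^ CARD('n)) * f h \<partial>lborel)"
  unfolding isotropic_gaussian_def by (rule nn_integral_density) auto

text \<open>The Cameron-Martin formula in finite dimension, obtained by expanding the square
  \<open>(norm (h - a))\<^sup>2\<close> in the shifted density.\<close>

lemma nn_integral_isotropic_gaussian_tilt:
  fixes G :: "real^'n \<Rightarrow> ennreal" and a :: "real^'n"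
  assumes v: "v > 0" and G [measurable]: "G \<in> borel_measurable borel"
  shows "(\<integral>\<^sup>+\<xi>. G (a + \<xi>) \<partial>isotropic_gaussian 0 v)
    = (\<integral>\<^sup>+h. G h * ennreal (exp (h \<bullet> a / v - (norm a)\<^sup>2 / (2 * v))) \<partial>isotropic_gaussian 0 v)"
proof -
  have "(\<integral>\<^sup>+\<xi>. G (a + \<xi>) \<partial>isotropic_gaussian 0 v) = (\<integral>\<^sup>+h. G h \<partial>isotropic_gaussian a v)"
    by (subst (2) isotropic_gaussian_shift) (simp add: nn_integral_distr)
  also have "\<dots> = (\<integral>\<^sup>+h. ennreal (exp (- (norm h)\<^sup>2 / (2 * v)) / sqrt (2 * pi * v) ^ CARD('n))
      * (G h * ennreal (exp (h \<bullet> a / v - (norm a)\<^sup>2 / (2 * v)))) \<partial>lborel)"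
    unfolding nn_integral_isotropic_gaussian[OF G]
  proof (rule nn_integral_cong)
    fix h :: "real^'n"
    have "- (norm (h - a))\<^sup>2 / (2 * v) = - (norm h)\<^sup>2 / (2 * v) + (h \<bullet> a / v - (norm a)\<^sup>2 / (2 * v))"
      using v by (simp add: power2_norm_eq_inner inner_simps inner_commute field_simps)
    then have eq: "exp (- (norm (h - a))\<^sup>2 / (2 * v)) / sqrt (2 * pi * v) ^ CARD('n)
        = exp (- (norm h)\<^sup>2 / (2 * v)) / sqrt (2 * pi * v) ^ CARD('n) * exp (h \<bullet> a / v - (norm a)\<^sup>2 / (2 * v))"
      by (simp only: exp_add times_divide_eq_left)
    show "ennreal (exp (- (norm (h - a))\<^sup>2 / (2 * v)) / sqrt (2 * pi * v) ^ CARD('n)) * G h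
        = ennreal (exp (- (norm h)\<^sup>2 / (2 * v)) / sqrt (2 * pi * v) ^ CARD('n))
          * (G h * ennreal (exp (h \<bullet> a / v - (norm a)\<^sup>2 / (2 * v))))"
      unfolding eq by (subst ennreal_mult'') (simp_all only: exp_ge_zero mult_ac)
  qed
  finally show ?thesis by (subst nn_integral_isotropic_gaussian) auto
qed

text \<open>Comparing \<open>\<psi>(h) = D(h) + \<parallel>h\<parallel>\<^sup>2/2v\<close> with \<open>\<psi>(h/2)\<close> replaces the usual integration by
  parts, which would need differentiability; the price is the non-sharp factor \<open>8 / 3 * 2 ^ n\<close>.\<close>

lemma log_concave_second_moment:
  fixes D :: "real^'n \<Rightarrow> real"
  assumes v: "v > 0" and D [measurable]: "D \<in> borel_measurable borel"
    and half: "\<And>h. D (h /\<^sub>R 2) \<le> D h"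
  shows "(\<integral>\<^sup>+h. ennreal ((norm h)\<^sup>2 * exp (- D h)) \<partial>isotropic_gaussian 0 v)
    \<le> ennreal (8 / 3 * 2 ^ CARD('n) * v) * (\<integral>\<^sup>+h. ennreal (exp (- D h)) \<partial>isotropic_gaussian 0 v)"
proof -
  define c where "c = inverse (sqrt (2 * pi * v) ^ CARD('n))"
  have c: "c \<ge> 0" using v by (simp add: c_def)
  define q where "q h = c * exp (- (norm h)\<^sup>2 / (2 * v)) * exp (- D h)" for h
  have [measurable]: "q \<in> borel_measurable borel" unfolding q_def by measurable
  have q_nonneg: "q h \<ge> 0" for h using c by (simp add: q_def)
  have lborel_eq: "(\<integral>\<^sup>+h. ennreal (r h * exp (- D h)) \<partial>isotropic_gaussian 0 v) = (\<integral>\<^sup>+h. ennreal (r h * q h) \<partial>lborel)"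
    if [measurable]: "r \<in> borel_measurable borel" for r :: "real^'n \<Rightarrow> real"
  proof (subst nn_integral_isotropic_gaussian)
    have "0 \<le> exp (- (norm (h - 0))\<^sup>2 / (2 * v)) / sqrt (2 * pi * v) ^ CARD('n)" for h :: "real^'n"
      using v by simp
    note mult = ennreal_mult'[OF this, symmetric]
    show "(\<integral>\<^sup>+h. ennreal (exp (- (norm (h - 0))\<^sup>2 / (2 * v)) / sqrt (2 * pi * v) ^ CARD('n))
        * ennreal (r h * exp (- D h)) \<partial>lborel) = (\<integral>\<^sup>+h. ennreal (r h * q h) \<partial>lborel)"
      unfolding mult unfolding q_def c_def divide_inverse diff_zero by (simp only: mult_ac)
  qed measurable
  have "(\<integral>\<^sup>+h. ennreal ((norm h)\<^sup>2 * exp (- D h)) \<partial>isotropic_gaussian 0 v) = (\<integral>\<^sup>+h. ennreal ((norm h)\<^sup>2 * q h) \<partial>lborel)"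
    by (rule lborel_eq) measurable
  also have "\<dots> \<le> (\<integral>\<^sup>+h. ennreal (8 / 3 * v) * ennreal (q (h /\<^sub>R 2)) \<partial>lborel)"
  proof (rule nn_integral_mono)
    fix h :: "real^'n"
    \<comment> \<open>The Gaussian exponents at \<open>h\<close> and at \<open>h /\<^sub>R 2\<close>
      have coefficients 1/2 and 1/8, and \<open>y\<close> carries their difference 3/8. Thus
      \<open>(norm h)\<^sup>2 = 8 / 3 * v * y\<close>, and \<open>y \<le> exp y\<close> trades the
      moment for the Gaussian factor at \<open>h /\<^sub>R 2\<close>.\<close>
    define y where "y = 3 * (norm h)\<^sup>2 / (8 * v)"
    have exp_split: "exp y * exp (- (norm h)\<^sup>2 / (2 * v)) = exp (y - (norm h)\<^sup>2 / (2 * v))"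
      unfolding exp_add[symmetric] by simp
    have exp_y: "y \<le> exp y" using exp_ge_add_one_self[of y] by linarith
    have "(norm h)\<^sup>2 = 8 / 3 * v * y" unfolding y_def using v by simp
    also have "\<dots> \<le> 8 / 3 * v * exp y" by (rule mult_left_mono[OF exp_y]) (use v in simp)
    finally have "(norm h)\<^sup>2 * q h \<le> 8 / 3 * v * exp y * q h" using q_nonneg by (rule mult_right_mono)
    also have "\<dots> = 8 / 3 * v * (c * (exp (y - (norm h)\<^sup>2 / (2 * v))) * exp (- D h))"
      unfolding q_def exp_split[symmetric] by (simp only: mult_ac)
    also have "\<dots> \<le> 8 / 3 * v * (c * (exp (y - (norm h)\<^sup>2 / (2 * v))) * exp (- D (h /\<^sub>R 2)))"
      using v c half by (intro mult_left_mono) auto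
    also have "y - (norm h)\<^sup>2 / (2 * v) = - (norm (h /\<^sub>R 2))\<^sup>2 / (2 * v)"
      using v by (simp add: y_def field_simps power2_eq_square)
    finally have "(norm h)\<^sup>2 * q h \<le> 8 / 3 * v * q (h /\<^sub>R 2)" by (simp add: q_def)
    then show "ennreal ((norm h)\<^sup>2 * q h) \<le> ennreal (8 / 3 * v) * ennreal (q (h /\<^sub>R 2))"
      using v q_nonneg by (simp add: ennreal_mult[symmetric] ennreal_leI)
  qed
  also have "\<dots> = ennreal (8 / 3 * v) * (\<integral>\<^sup>+h. ennreal (q (h /\<^sub>R 2)) \<partial>lborel)"
    by (rule nn_integral_cmult) measurable
  \<comment> \<open>The substitution of \<open>2 *\<^sub>R h\<close> for \<open>h\<close> has
    Jacobian \<open>2 ^ CARD('n)\<close>.\<close>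
  also have "(\<integral>\<^sup>+h. ennreal (q (h /\<^sub>R 2)) \<partial>lborel) = ennreal (2 ^ CARD('n)) * (\<integral>\<^sup>+h. ennreal (q h) \<partial>lborel)"
    by (subst lborel_affine[of 2 0]) (simp_all add: nn_integral_density nn_integral_distr nn_integral_cmult)
  also have "(\<integral>\<^sup>+h. ennreal (q h) \<partial>lborel) = (\<integral>\<^sup>+h. ennreal (exp (- D h)) \<partial>isotropic_gaussian 0 v)"
    using lborel_eq[of "\<lambda>_. 1"] by simp
  finally have "(\<integral>\<^sup>+h. ennreal ((norm h)\<^sup>2 * exp (- D h)) \<partial>isotropic_gaussian 0 v) \<le> ennreal (8 / 3 * v)
      * (ennreal (2 ^ CARD('n)) * (\<integral>\<^sup>+h. ennreal (exp (- D h)) \<partial>isotropic_gaussian 0 v))" .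
  moreover have "ennreal (8 / 3 * 2 ^ CARD('n) * v) = ennreal (8 / 3 * v) * ennreal (2 ^ CARD('n))"
    by (subst ennreal_mult''[symmetric]) (simp_all add: mult_ac)
  ultimately show ?thesis by (simp only: mult.assoc)
qed

text \<open>The comparison above with exponent 0. The exact moment is \<open>CARD('n) * v\<close>;
  with the weaker bound one constant serves both the weighted and the unweighted Gaussian.\<close>

lemma isotropic_gaussian_second_moment:
  fixes v :: real
  assumes v: "v > 0"
  shows "integrable (isotropic_gaussian (0::real^'n) v) (\<lambda>h. (norm h)\<^sup>2)"
    and "(\<integral>h. (norm h)\<^sup>2 \<partial>isotropic_gaussian (0::real^'n) v) \<le> 8 / 3 * 2 ^ CARD('n) * v"
proof -
  interpret prob_space "isotropic_gaussian (0::real^'n) v" by (rule prob_space_isotropic_gaussian[OF v])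
  define C where "C = 8 / 3 * 2 ^ CARD('n) * v"
  have "(\<integral>\<^sup>+h. ennreal (exp (- 0)) \<partial>isotropic_gaussian (0::real^'n) v) = 1"
    using emeasure_space_1 by simp
  then have le: "(\<integral>\<^sup>+h. ennreal ((norm h)\<^sup>2) \<partial>isotropic_gaussian (0::real^'n) v) \<le> ennreal C"
    using log_concave_second_moment[OF v, of "\<lambda>_::real^'n. 0", folded C_def] by simp
  then have "(\<integral>\<^sup>+h. ennreal ((norm h)\<^sup>2) \<partial>isotropic_gaussian (0::real^'n) v) < \<infinity>"
    by (rule order.strict_trans1) simp
  then show int: "integrable (isotropic_gaussian (0::real^'n) v) (\<lambda>h. (norm h)\<^sup>2)"
    by (intro integrableI_nonneg) auto
  have "ennreal (\<integral>h. (norm h)\<^sup>2 \<partial>isotropic_gaussian (0::real^'n) v) \<le> ennreal C"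
    using le nn_integral_eq_integral[OF int] by simp
  moreover have "C \<ge> 0" using v by (simp add: C_def)
  ultimately show "(\<integral>h. (norm h)\<^sup>2 \<partial>isotropic_gaussian (0::real^'n) v) \<le> 8 / 3 * 2 ^ CARD('n) * v"
    unfolding C_def[symmetric] by (simp add: ennreal_le_iff)
qed

lemma integrable_nn_integral_le:
  fixes f :: "'a \<Rightarrow> real"
  assumes "f \<in> borel_measurable M" "\<And>x. 0 \<le> f x" "(\<integral>\<^sup>+x. ennreal (f x) \<partial>M) \<le> ennreal C" "0 \<le> C"
  shows "integrable M f" "(\<integral>x. f x \<partial>M) \<le> C"
proof -
  have "(\<integral>\<^sup>+x. ennreal (f x) \<partial>M) < \<infinity>"
    using assms(3) by (rule order.strict_trans1) simp
  then show int: "integrable M f" using assms(1,2) by (intro integrableI_nonneg) auto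
  have "ennreal (\<integral>x. f x \<partial>M) \<le> ennreal C"
    using assms(3) nn_integral_eq_integral[OF int] assms(2) by simp
  then show "(\<integral>x. f x \<partial>M) \<le> C" using assms(4) by (simp add: ennreal_le_iff)
qed

section \<open>Moments of the weights around a fixed centre\<close>

locale proximal_weights =
  fixes F :: "real^'n \<Rightarrow> real" and L t \<delta> :: real and c :: "real^'n"
  assumes convex: "convex_on UNIV F" and lip: "L-lipschitz_on UNIV F"
    and t: "t > 0" and \<delta>: "\<delta> > 0"
begin

abbreviation "v \<equiv> \<delta> * t"
abbreviation "\<gamma> \<equiv> isotropic_gaussian (0::real^'n) v"
definition "p = prox t F c"
definition "a = c - p"
definition "w \<xi> = exp (- F (c + \<xi>) / \<delta>)"
definition "K = 8 / 3 * 2 ^ CARD('n) * v"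

text \<open>With \<open>a / t\<close> the subgradient of \<open>F\<close> at \<open>p\<close>, the weighted Gaussian around \<open>c\<close> has, in the
  variable \<open>h = z - p\<close>, density \<open>exp (- D h)\<close> with respect to the centred Gaussian, up to a factor.\<close>

definition "D h = (F (p + h) - F p) / \<delta> - (a \<bullet> h) / v"

lemma v_pos: "v > 0" using t \<delta> by simp

lemma K_pos: "K > 0" using v_pos by (simp add: K_def)

lemma L_nonneg: "L \<ge> 0" using lipschitz_on_nonneg[OF lip] .

lemma measurable_F [measurable]: "F \<in> borel_measurable borel"
  using lipschitz_on_continuous_on[OF lip] by (rule borel_measurable_continuous_onI)

lemma measurable_w [measurable]: "w \<in> borel_measurable borel"
  unfolding w_def by measurable

lemma w_nonneg: "0 \<le> w \<xi>" by (simp add: w_def)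

lemma measurable_D [measurable]: "D \<in> borel_measurable borel"
  unfolding D_def by measurable

lemma prob_space_\<gamma>: "prob_space \<gamma>" by (rule prob_space_isotropic_gaussian[OF v_pos])

lemma measure_\<gamma>_UNIV [simp]: "measure \<gamma> UNIV = 1"
  using prob_space.prob_space[OF prob_space_\<gamma>] by simp

lemma subgradient_a: "subgradient F p (a /\<^sub>R t)"
  unfolding p_def a_def by (rule subgradient_prox[OF convex lip t])

lemma norm_a_le: "norm a \<le> t * L"
  using norm_subgradient_le[OF subgradient_a lip] t by (simp add: field_simps)

lemma D_nonneg: "0 \<le> D h"
proof -
  have "(a \<bullet> h) / t \<le> F (p + h) - F p"
    using subgradientD[OF subgradient_a, of "p + h"] by (simp add: divide_inverse mult.commute)
  then have "(a \<bullet> h) / t / \<delta> \<le> (F (p + h) - F p) / \<delta>" using \<delta> by (intro divide_right_mono) auto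
  moreover have "(a \<bullet> h) / t / \<delta> = (a \<bullet> h) / v"
    by (simp only: divide_divide_eq_left mult.commute[of t \<delta>])
  ultimately show ?thesis unfolding D_def by linarith
qed

text \<open>Convexity and \<open>D 0 = 0\<close> give
  \<open>D (h /\<^sub>R 2) \<le> D h / 2\<close>, and nonnegativity removes the factor. This is the
  hypothesis on the exponent in \<open>log_concave_second_moment\<close>.\<close>

lemma D_half: "D (h /\<^sub>R 2) \<le> D h"
proof -
  have "p + h /\<^sub>R 2 = (1 - 1 / 2) *\<^sub>R p + (1 / 2) *\<^sub>R (p + h)"
    by (simp add: vec_eq_iff field_simps)
  then have "F (p + h /\<^sub>R 2) \<le> (1 - 1 / 2) * F p + 1 / 2 * F (p + h)"
    using convex_onD[OF convex, of "1 / 2" p "p + h"] by simp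
  then have "F (p + h /\<^sub>R 2) - F p \<le> (F (p + h) - F p) / 2" by argo
  then have "(F (p + h /\<^sub>R 2) - F p) / \<delta> \<le> (F (p + h) - F p) / 2 / \<delta>"
    using \<delta> by (intro divide_right_mono) auto
  moreover have "a \<bullet> (h /\<^sub>R 2) / v = (a \<bullet> h) / v / 2" by simp
  moreover have "(F (p + h) - F p) / 2 / \<delta> = (F (p + h) - F p) / \<delta> / 2" by simp
  ultimately have "D (h /\<^sub>R 2) \<le> D h / 2" unfolding D_def by argo
  then show ?thesis using D_nonneg[of h] by linarith
qed

lemma D_le: "D h \<le> 2 * L * norm h / \<delta>"
proof -
  have "F (p + h) - F p \<le> L * norm h"
    using lipschitz_onD[OF lip, of "p + h" p] by (simp add: dist_norm)
  moreover have "- (a \<bullet> h) / t \<le> L * norm h"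
  proof -
    have "- (a \<bullet> h) \<le> norm a * norm h" using norm_cauchy_schwarz[of "- a" h] by simp
    also have "\<dots> \<le> t * L * norm h" using norm_a_le by (intro mult_right_mono) auto
    finally show ?thesis using t by (simp add: field_simps)
  qed
  ultimately have "(F (p + h) - F p - (a \<bullet> h) / t) / \<delta> \<le> 2 * L * norm h / \<delta>"
    using \<delta> by (intro divide_right_mono) auto
  moreover have "(F (p + h) - F p - (a \<bullet> h) / t) / \<delta> = D h"
    by (simp only: D_def diff_divide_distrib divide_divide_eq_left mult.commute[of t \<delta>])
  ultimately show ?thesis by simp
qed

definition "a0 = exp (- F p / \<delta> - (norm a)\<^sup>2 / (2 * v))"

text \<open>In the variable \<open>h = a + \<xi>\<close> the sample \<open>c + \<xi>\<close> is
  \<open>p + h\<close>. The linear term of the tilt by \<open>a\<close> is the subgradient term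
  subtracted in \<open>D\<close>; \<open>a0\<close> collects the value of \<open>F\<close> at
  \<open>p\<close> and the normalization of the tilt.\<close>

lemma nn_integral_w:
  assumes [measurable]: "\<Phi> \<in> borel_measurable borel"
  shows "(\<integral>\<^sup>+\<xi>. ennreal (\<Phi> (a + \<xi>) * w \<xi>) \<partial>\<gamma>) = ennreal a0 * (\<integral>\<^sup>+h. ennreal (\<Phi> h * exp (- D h)) \<partial>\<gamma>)"
proof -
  define G where "G h = ennreal (\<Phi> h * exp (- F (p + h) / \<delta>))" for h
  have [measurable]: "G \<in> borel_measurable borel" unfolding G_def by measurable
  have "(\<integral>\<^sup>+\<xi>. ennreal (\<Phi> (a + \<xi>) * w \<xi>) \<partial>\<gamma>) = (\<integral>\<^sup>+\<xi>. G (a + \<xi>) \<partial>\<gamma>)"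
    by (simp add: G_def w_def a_def)
  also have "\<dots> = (\<integral>\<^sup>+h. G h * ennreal (exp (h \<bullet> a / v - (norm a)\<^sup>2 / (2 * v))) \<partial>\<gamma>)"
    by (rule nn_integral_isotropic_gaussian_tilt[OF v_pos]) measurable
  also have "\<dots> = (\<integral>\<^sup>+h. ennreal a0 * ennreal (\<Phi> h * exp (- D h)) \<partial>\<gamma>)"
  proof (rule nn_integral_cong)
    fix h
    have "- F (p + h) / \<delta> + (h \<bullet> a / v - (norm a)\<^sup>2 / (2 * v))
        = (- F p / \<delta> - (norm a)\<^sup>2 / (2 * v)) + - D h"
      by (simp add: D_def inner_commute diff_divide_distrib)
    then have e: "exp (- F (p + h) / \<delta>) * exp (h \<bullet> a / v - (norm a)\<^sup>2 / (2 * v)) = a0 * exp (- D h)"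
      unfolding a0_def exp_add[symmetric] by simp
    have "G h * ennreal (exp (h \<bullet> a / v - (norm a)\<^sup>2 / (2 * v)))
        = ennreal (\<Phi> h * (exp (- F (p + h) / \<delta>) * exp (h \<bullet> a / v - (norm a)\<^sup>2 / (2 * v))))"
      unfolding G_def by (subst ennreal_mult''[symmetric]) (simp_all only: exp_ge_zero mult.assoc)
    also have "\<dots> = ennreal (a0 * (\<Phi> h * exp (- D h)))"
      unfolding e by (simp only: mult_ac)
    also have "\<dots> = ennreal a0 * ennreal (\<Phi> h * exp (- D h))"
      by (rule ennreal_mult') (simp add: a0_def)
    finally show "G h * ennreal (exp (h \<bullet> a / v - (norm a)\<^sup>2 / (2 * v)))
      = ennreal a0 * ennreal (\<Phi> h * exp (- D h))" .
  qed
  also have "\<dots> = ennreal a0 * (\<integral>\<^sup>+h. ennreal (\<Phi> h * exp (- D h)) \<partial>\<gamma>)"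
    by (rule nn_integral_cmult) measurable
  finally show ?thesis .
qed

definition "a1 = exp (- 2 * F p / \<delta>)"

text \<open>Bounding \<open>F\<close> below by its supporting hyperplane at \<open>p\<close> gives
  the squared weight the linear exponent \<open>- 2 * (a \<bullet> h) / v\<close>. Combined with the
  tilt by \<open>a\<close>, this is the tilt by \<open>- a\<close>: the shift is reflected, and only
  the constant \<open>a1\<close> remains.\<close>

lemma nn_integral_w_square_le:
  assumes [measurable]: "\<Phi> \<in> borel_measurable borel" and \<Phi>: "\<And>h. 0 \<le> \<Phi> h"
  shows "(\<integral>\<^sup>+\<xi>. ennreal (\<Phi> (a + \<xi>) * (w \<xi>)\<^sup>2) \<partial>\<gamma>) \<le> ennreal a1 * (\<integral>\<^sup>+\<xi>. ennreal (\<Phi> (- a + \<xi>)) \<partial>\<gamma>)"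
proof -
  define G where "G h = ennreal (a1 * \<Phi> h * exp (- 2 * (a \<bullet> h) / v))" for h
  have [measurable]: "G \<in> borel_measurable borel" unfolding G_def by measurable
  have "(\<integral>\<^sup>+\<xi>. ennreal (\<Phi> (a + \<xi>) * (w \<xi>)\<^sup>2) \<partial>\<gamma>) \<le> (\<integral>\<^sup>+\<xi>. G (a + \<xi>) \<partial>\<gamma>)"
  proof (rule nn_integral_mono)
    fix \<xi>
    have "- 2 * F (c + \<xi>) / \<delta> \<le> - 2 * F p / \<delta> + - 2 * (a \<bullet> (a + \<xi>)) / v"
      using D_nonneg[of "a + \<xi>"] by (simp add: D_def a_def diff_divide_distrib)
    then have "exp (- 2 * F (c + \<xi>) / \<delta>) \<le> a1 * exp (- 2 * (a \<bullet> (a + \<xi>)) / v)"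
      unfolding a1_def exp_add[symmetric] by (simp only: exp_le_cancel_iff)
    moreover have "(w \<xi>)\<^sup>2 = exp (- 2 * F (c + \<xi>) / \<delta>)"
      by (simp add: w_def power2_eq_square exp_add[symmetric])
    ultimately have "\<Phi> (a + \<xi>) * (w \<xi>)\<^sup>2 \<le> \<Phi> (a + \<xi>) * (a1 * exp (- 2 * (a \<bullet> (a + \<xi>)) / v))"
      using \<Phi> by (intro mult_left_mono) simp_all
    then show "ennreal (\<Phi> (a + \<xi>) * (w \<xi>)\<^sup>2) \<le> G (a + \<xi>)"
      unfolding G_def by (intro ennreal_leI) (simp only: mult_ac)
  qed
  also have "\<dots> = (\<integral>\<^sup>+h. G h * ennreal (exp (h \<bullet> a / v - (norm a)\<^sup>2 / (2 * v))) \<partial>\<gamma>)"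
    by (rule nn_integral_isotropic_gaussian_tilt[OF v_pos]) measurable
  also have "\<dots> = (\<integral>\<^sup>+h. ennreal (a1 * \<Phi> h) * ennreal (exp (h \<bullet> (- a) / v - (norm (- a))\<^sup>2 / (2 * v))) \<partial>\<gamma>)"
  proof (rule nn_integral_cong)
    fix h
    have "- 2 * (a \<bullet> h) / v + (h \<bullet> a / v - (norm a)\<^sup>2 / (2 * v)) = h \<bullet> (- a) / v - (norm (- a))\<^sup>2 / (2 * v)"
      by (simp add: inner_commute)
    then have e: "exp (- 2 * (a \<bullet> h) / v) * exp (h \<bullet> a / v - (norm a)\<^sup>2 / (2 * v))
        = exp (h \<bullet> (- a) / v - (norm (- a))\<^sup>2 / (2 * v))"
      unfolding exp_add[symmetric] by simp
    show "G h * ennreal (exp (h \<bullet> a / v - (norm a)\<^sup>2 / (2 * v)))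
        = ennreal (a1 * \<Phi> h) * ennreal (exp (h \<bullet> (- a) / v - (norm (- a))\<^sup>2 / (2 * v)))"
      unfolding G_def e[symmetric] by (simp only: ennreal_mult''[OF exp_ge_zero]) (simp only: mult.assoc)
  qed
  also have "\<dots> = (\<integral>\<^sup>+\<xi>. ennreal (a1 * \<Phi> (- a + \<xi>)) \<partial>\<gamma>)"
    by (rule nn_integral_isotropic_gaussian_tilt[OF v_pos, symmetric]) measurable
  also have "\<dots> = (\<integral>\<^sup>+\<xi>. ennreal a1 * ennreal (\<Phi> (- a + \<xi>)) \<partial>\<gamma>)"
    by (simp add: ennreal_mult' a1_def)
  also have "\<dots> = ennreal a1 * (\<integral>\<^sup>+\<xi>. ennreal (\<Phi> (- a + \<xi>)) \<partial>\<gamma>)"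
    by (rule nn_integral_cmult) measurable
  finally show ?thesis .
qed

lemma integrable_exp_D: "integrable \<gamma> (\<lambda>h. exp (- D h))"
proof -
  interpret prob_space \<gamma> by (rule prob_space_\<gamma>)
  show ?thesis by (rule integrable_const_bound[where B = 1]) (use D_nonneg in auto)
qed

text \<open>Jensen's inequality, through the tangent of \<open>exp\<close> at \<open>- 2 L \<surd>K / \<delta>\<close>.\<close>

lemma integral_exp_D_ge: "exp (- (2 * L * sqrt K / \<delta>)) \<le> (\<integral>h. exp (- D h) \<partial>\<gamma>)"
proof -
  interpret prob_space \<gamma> by (rule prob_space_\<gamma>)
  define r where "r = sqrt K"
  have r: "r > 0" "r\<^sup>2 = K" using K_pos by (auto simp: r_def)
  define m where "m = 2 * L * r / \<delta>"
  \<comment> \<open>A pointwise minorant of \<open>exp (- D h)\<close>: the tangent of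
    \<open>exp\<close> at \<open>- m\<close>, the linear bound \<open>D_le\<close>, and
    \<open>norm h \<le> (norm h)\<^sup>2 / (2 * r) + r / 2\<close>. Its integral needs only the
    second moment, and \<open>r = sqrt K\<close> makes the integral of that last bound at most
    \<open>r\<close>.\<close>
  define \<phi> where "\<phi> h = exp (- m) * (1 + m - 2 * L / \<delta> * ((norm h)\<^sup>2 / (2 * r) + r / 2))" for h :: "real^'n"
  note sq = isotropic_gaussian_second_moment[OF v_pos, where 'n = 'n, folded K_def]
  have "exp (- m) \<le> (\<integral>h. \<phi> h \<partial>\<gamma>)"
  proof -
    have "(\<integral>h. \<phi> h \<partial>\<gamma>) = exp (- m) * (1 + m - 2 * L / \<delta> * ((\<integral>h. (norm h)\<^sup>2 \<partial>\<gamma>) / (2 * r) + r / 2))"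
      unfolding \<phi>_def using sq(1) by (simp add: prob_space)
    moreover have "(\<integral>h. (norm h)\<^sup>2 \<partial>\<gamma>) / (2 * r) \<le> r\<^sup>2 / (2 * r)"
      using sq(2) r by (intro divide_right_mono) auto
    then have "(\<integral>h. (norm h)\<^sup>2 \<partial>\<gamma>) / (2 * r) + r / 2 \<le> r"
      using r by (simp add: power2_eq_square)
    then have "2 * L / \<delta> * ((\<integral>h. (norm h)\<^sup>2 \<partial>\<gamma>) / (2 * r) + r / 2) \<le> 2 * L / \<delta> * r"
      using L_nonneg \<delta> by (intro mult_left_mono) auto
    then have "1 \<le> 1 + m - 2 * L / \<delta> * ((\<integral>h. (norm h)\<^sup>2 \<partial>\<gamma>) / (2 * r) + r / 2)"
      by (simp add: m_def)
    ultimately show ?thesis using mult_left_mono[of 1 _ "exp (- m)"] by simp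
  qed
  also have "\<dots> \<le> (\<integral>h. exp (- D h) \<partial>\<gamma>)"
  proof (rule integral_mono)
    show "integrable \<gamma> \<phi>" unfolding \<phi>_def using sq(1) by simp
    fix h :: "real^'n"
    have "0 \<le> (norm h - r)\<^sup>2" by simp
    then have "2 * r * norm h \<le> (norm h)\<^sup>2 + r\<^sup>2" by (simp add: power2_diff mult_ac)
    then have "norm h \<le> (norm h)\<^sup>2 / (2 * r) + r / 2"
      using r(1) by (simp add: field_simps power2_eq_square)
    then have "2 * L / \<delta> * norm h \<le> 2 * L / \<delta> * ((norm h)\<^sup>2 / (2 * r) + r / 2)"
      using L_nonneg \<delta> by (intro mult_left_mono) auto
    moreover have "D h \<le> 2 * L / \<delta> * norm h" using D_le[of h] by simp
    ultimately have "1 + m - 2 * L / \<delta> * ((norm h)\<^sup>2 / (2 * r) + r / 2) \<le> 1 + (m - D h)" by linarith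
    also have "\<dots> \<le> exp (m - D h)" by (rule exp_ge_add_one_self)
    finally have "\<phi> h \<le> exp (- m) * exp (m - D h)" unfolding \<phi>_def by (intro mult_left_mono) auto
    then show "\<phi> h \<le> exp (- D h)" by (simp add: exp_add[symmetric])
  qed (rule integrable_exp_D)
  finally show ?thesis by (simp add: m_def r_def)
qed

definition "V = (\<integral>\<xi>. w \<xi> \<partial>\<gamma>)"

lemma V_ge: "a0 * exp (- (2 * L * sqrt K / \<delta>)) \<le> V"
  and V_pos: "V > 0" and integrable_w: "integrable \<gamma> w"
  and nn_integral_w_V: "(\<integral>\<^sup>+\<xi>. ennreal (w \<xi>) \<partial>\<gamma>) = ennreal V"
proof -
  have a0: "a0 > 0" by (simp add: a0_def)
  have nn: "(\<integral>\<^sup>+\<xi>. ennreal (w \<xi>) \<partial>\<gamma>) = ennreal (a0 * (\<integral>h. exp (- D h) \<partial>\<gamma>))"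
    using nn_integral_w[of "\<lambda>_. 1"] nn_integral_eq_integral[OF integrable_exp_D] a0
    by (simp add: ennreal_mult')
  then show int: "integrable \<gamma> w"
    by (intro integrableI_nonneg) (auto simp: w_def)
  have "ennreal V = (\<integral>\<^sup>+\<xi>. ennreal (w \<xi>) \<partial>\<gamma>)"
    unfolding V_def by (rule nn_integral_eq_integral[OF int, symmetric]) (simp add: w_def)
  then show nnV: "(\<integral>\<^sup>+\<xi>. ennreal (w \<xi>) \<partial>\<gamma>) = ennreal V" by simp
  have "V \<ge> 0" unfolding V_def by (simp add: w_def)
  moreover have "(\<integral>h. exp (- D h) \<partial>\<gamma>) \<ge> 0" by simp
  ultimately have "V = a0 * (\<integral>h. exp (- D h) \<partial>\<gamma>)"
    using nn nnV a0 by (simp add: ennreal_inj)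
  then show ge: "a0 * exp (- (2 * L * sqrt K / \<delta>)) \<le> V"
    using integral_exp_D_ge a0 by simp
  have "0 < a0 * exp (- (2 * L * sqrt K / \<delta>))" using a0 by simp
  then show "V > 0" using ge by (rule less_le_trans)
qed

text \<open>The integrals on both sides carry the factor \<open>a0\<close>, so the log-concave
  comparison passes to the law weighted by \<open>w\<close> without loss.\<close>

lemma integral_w_norm_square_le:
  shows "integrable \<gamma> (\<lambda>\<xi>. (norm (a + \<xi>))\<^sup>2 * w \<xi>)"
    and "(\<integral>\<xi>. (norm (a + \<xi>))\<^sup>2 * w \<xi> \<partial>\<gamma>) \<le> K * V"
proof -
  have "(\<integral>\<^sup>+\<xi>. ennreal ((norm (a + \<xi>))\<^sup>2 * w \<xi>) \<partial>\<gamma>)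
      = ennreal a0 * (\<integral>\<^sup>+h. ennreal ((norm h)\<^sup>2 * exp (- D h)) \<partial>\<gamma>)"
    by (rule nn_integral_w) measurable
  also have "\<dots> \<le> ennreal a0 * (ennreal K * (\<integral>\<^sup>+h. ennreal (exp (- D h)) \<partial>\<gamma>))"
    unfolding K_def by (intro mult_left_mono log_concave_second_moment v_pos D_half measurable_D) simp
  also have "\<dots> = ennreal K * (\<integral>\<^sup>+\<xi>. ennreal (w \<xi>) \<partial>\<gamma>)"
    using nn_integral_w[of "\<lambda>_. 1"] by (simp add: mult_ac)
  also have "\<dots> = ennreal (K * V)" using K_pos V_pos by (simp add: nn_integral_w_V ennreal_mult)
  finally have le: "(\<integral>\<^sup>+\<xi>. ennreal ((norm (a + \<xi>))\<^sup>2 * w \<xi>) \<partial>\<gamma>) \<le> ennreal (K * V)" .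
  show "integrable \<gamma> (\<lambda>\<xi>. (norm (a + \<xi>))\<^sup>2 * w \<xi>)" "(\<integral>\<xi>. (norm (a + \<xi>))\<^sup>2 * w \<xi> \<partial>\<gamma>) \<le> K * V"
    by (rule integrable_nn_integral_le[OF _ _ le]; use K_pos V_pos in \<open>simp add: w_def\<close>)+
qed

text \<open>In effect Cauchy-Schwarz for the weighted law: the pointwise arithmetic-geometric mean
  bound with \<open>r = sqrt K\<close> gives the same constant. As \<open>K\<close> is proportional
  to \<open>\<delta>\<close>, the bias is of order \<open>sqrt \<delta>\<close>.\<close>

lemma norm_bias_le: "norm (\<integral>\<xi>. w \<xi> *\<^sub>R (a + \<xi>) \<partial>\<gamma>) \<le> sqrt K * V"
proof -
  define r where "r = sqrt K"
  have r: "r > 0" "r\<^sup>2 = K" using K_pos by (auto simp: r_def)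
  define \<phi> where "\<phi> \<xi> = (norm (a + \<xi>))\<^sup>2 * w \<xi> / (2 * r) + r / 2 * w \<xi>" for \<xi>
  have le: "norm (w \<xi> *\<^sub>R (a + \<xi>)) \<le> \<phi> \<xi>" for \<xi>
  proof -
    have "0 \<le> (norm (a + \<xi>) - r)\<^sup>2" by simp
    then have "2 * r * norm (a + \<xi>) \<le> (norm (a + \<xi>))\<^sup>2 + r\<^sup>2" by (simp add: power2_diff mult_ac)
    then have "norm (a + \<xi>) \<le> (norm (a + \<xi>))\<^sup>2 / (2 * r) + r / 2"
      using r(1) by (simp add: field_simps power2_eq_square)
    then have "w \<xi> * norm (a + \<xi>) \<le> w \<xi> * ((norm (a + \<xi>))\<^sup>2 / (2 * r) + r / 2)"
      by (intro mult_left_mono) (auto simp: w_def)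
    moreover have "norm (w \<xi> *\<^sub>R (a + \<xi>)) = w \<xi> * norm (a + \<xi>)"
      by (simp only: norm_scaleR real_norm_def abs_of_nonneg[OF w_nonneg])
    moreover have "w \<xi> * ((norm (a + \<xi>))\<^sup>2 / (2 * r) + r / 2) = \<phi> \<xi>"
      by (simp add: \<phi>_def distrib_left mult.commute)
    ultimately show ?thesis by (simp only:)
  qed
  have int: "integrable \<gamma> \<phi>"
    unfolding \<phi>_def using integral_w_norm_square_le(1) integrable_w by simp
  have "norm (w \<xi> *\<^sub>R (a + \<xi>)) \<le> norm (\<phi> \<xi>)" for \<xi>
    using le[of \<xi>] by (metis abs_ge_self order_trans real_norm_def)
  then have "integrable \<gamma> (\<lambda>\<xi>. w \<xi> *\<^sub>R (a + \<xi>))"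
    by (intro Bochner_Integration.integrable_bound[OF int] AE_I2) measurable
  then have "norm (\<integral>\<xi>. w \<xi> *\<^sub>R (a + \<xi>) \<partial>\<gamma>) \<le> (\<integral>\<xi>. \<phi> \<xi> \<partial>\<gamma>)"
    by (rule Bochner_Integration.integral_norm_bound_integral[OF _ int le])
  also have "(\<integral>\<xi>. \<phi> \<xi> \<partial>\<gamma>) = (\<integral>\<xi>. (norm (a + \<xi>))\<^sup>2 * w \<xi> \<partial>\<gamma>) / (2 * r) + r / 2 * V"
    unfolding \<phi>_def V_def using integral_w_norm_square_le(1) integrable_w by simp
  also have "\<dots> \<le> r\<^sup>2 * V / (2 * r) + r / 2 * V"
    using integral_w_norm_square_le(2) r by (intro add_right_mono divide_right_mono) auto
  also have "\<dots> = r * V" using r(1) by (simp add: power2_eq_square)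
  finally show ?thesis by (simp add: r_def)
qed

text \<open>The factor \<open>exp (L\<^sup>2 t / \<delta>)\<close> is half of the admissible exponent; the other half absorbs
  the loss in Jensen's inequality by \<open>4 L r \<le> L\<^sup>2 t + 4 r\<^sup>2 / t\<close>.\<close>

lemma a1_le: "a1 \<le> exp (4 * (8 / 3 * 2 ^ CARD('n))) * exp (2 / \<delta> * L\<^sup>2 * t) * V\<^sup>2"
proof -
  define k where "k = (8 / 3 * 2 ^ CARD('n) :: real)"
  define r where "r = sqrt K"
  have r: "r\<^sup>2 = k * \<delta> * t" using K_pos by (simp add: r_def) (simp add: K_def k_def)
  have "(norm a)\<^sup>2 \<le> (t * L)\<^sup>2" using norm_a_le by (intro power_mono) auto
  moreover have "0 \<le> (L * t - 2 * r)\<^sup>2" by simp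
  then have "4 * L * t * r \<le> (L * t)\<^sup>2 + 4 * (k * \<delta> * t)" by (simp add: power2_diff r power_mult_distrib mult_ac)
  moreover have "(4 * k + 2 / \<delta> * L\<^sup>2 * t) * v = 4 * (k * \<delta> * t) + (t * L)\<^sup>2 + (L * t)\<^sup>2"
    using \<delta> by (simp add: field_simps power2_eq_square)
  ultimately have "(norm a)\<^sup>2 + 4 * L * t * r \<le> (4 * k + 2 / \<delta> * L\<^sup>2 * t) * v"
    by linarith
  then have "((norm a)\<^sup>2 + 4 * L * t * r) / v \<le> 4 * k + 2 / \<delta> * L\<^sup>2 * t"
    using v_pos by (simp add: pos_divide_le_eq)
  moreover have "((norm a)\<^sup>2 + 4 * L * t * r) / v = (norm a)\<^sup>2 / v + 4 * L * r / \<delta>"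
    using t \<delta> by (simp add: field_simps)
  ultimately have "- 2 * F p / \<delta> \<le> (4 * k + 2 / \<delta> * L\<^sup>2 * t)
      + ((- F p / \<delta> - (norm a)\<^sup>2 / (2 * v) + - (2 * L * r / \<delta>)) + (- F p / \<delta> - (norm a)\<^sup>2 / (2 * v) + - (2 * L * r / \<delta>)))"
    by (simp add: field_simps)
  then have "a1 \<le> exp (4 * k) * exp (2 / \<delta> * L\<^sup>2 * t) * (a0 * exp (- (2 * L * r / \<delta>)))\<^sup>2"
    unfolding a1_def a0_def power2_eq_square exp_add[symmetric] by (simp only: exp_le_cancel_iff)
  also have "\<dots> \<le> exp (4 * k) * exp (2 / \<delta> * L\<^sup>2 * t) * V\<^sup>2"
    using V_ge by (intro mult_left_mono power_mono) (auto simp: r_def a0_def)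
  finally show ?thesis by (simp add: k_def)
qed

lemma integral_w_square_le:
  shows "integrable \<gamma> (\<lambda>\<xi>. (w \<xi>)\<^sup>2)" and "(\<integral>\<xi>. (w \<xi>)\<^sup>2 \<partial>\<gamma>) \<le> a1"
proof -
  interpret prob_space \<gamma> by (rule prob_space_\<gamma>)
  have le: "(\<integral>\<^sup>+\<xi>. ennreal ((w \<xi>)\<^sup>2) \<partial>\<gamma>) \<le> ennreal a1"
    using nn_integral_w_square_le[of "\<lambda>_. 1"] emeasure_space_1 by simp
  show "integrable \<gamma> (\<lambda>\<xi>. (w \<xi>)\<^sup>2)" "(\<integral>\<xi>. (w \<xi>)\<^sup>2 \<partial>\<gamma>) \<le> a1"
    by (rule integrable_nn_integral_le[OF _ _ le]; simp add: a1_def)+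
qed

text \<open>After the reflection in \<open>nn_integral_w_square_le\<close>, what remains is the
  second moment of a Gaussian whose mean \<open>- a\<close> has norm at most
  \<open>t * L\<close>.\<close>

lemma integral_norm_w_square_le:
  shows "integrable \<gamma> (\<lambda>\<xi>. (norm (w \<xi> *\<^sub>R (a + \<xi>)))\<^sup>2)"
    and "(\<integral>\<xi>. (norm (w \<xi> *\<^sub>R (a + \<xi>)))\<^sup>2 \<partial>\<gamma>) \<le> a1 * (2 * (t * L)\<^sup>2 + 2 * K)"
proof -
  interpret prob_space \<gamma> by (rule prob_space_\<gamma>)
  note sq = isotropic_gaussian_second_moment[OF v_pos, where 'n = 'n, folded K_def]
  have eq: "(norm (w \<xi> *\<^sub>R (a + \<xi>)))\<^sup>2 = (norm (a + \<xi>))\<^sup>2 * (w \<xi>)\<^sup>2" for \<xi>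
    by (simp add: power_mult_distrib mult.commute)
  define C where "C = 2 * (t * L)\<^sup>2 + 2 * K"
  have aC: "a1 * C \<ge> 0" using K_pos by (simp add: C_def a1_def)
  have meas: "(\<lambda>\<xi>. (norm (w \<xi> *\<^sub>R (a + \<xi>)))\<^sup>2) \<in> borel_measurable \<gamma>" by measurable
  have "(\<integral>\<^sup>+\<xi>. ennreal ((norm (- a + \<xi>))\<^sup>2) \<partial>\<gamma>) \<le> (\<integral>\<^sup>+\<xi>. ennreal (2 * (t * L)\<^sup>2 + 2 * (norm \<xi>)\<^sup>2) \<partial>\<gamma>)"
  proof (intro nn_integral_mono ennreal_leI)
    fix \<xi>
    have "(norm (- a + \<xi>))\<^sup>2 \<le> (norm a + norm \<xi>)\<^sup>2"
      using norm_triangle_ineq[of "- a" \<xi>] by (intro power_mono) auto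
    also have "\<dots> \<le> 2 * (norm a)\<^sup>2 + 2 * (norm \<xi>)\<^sup>2"
      using zero_le_power2[of "norm a - norm \<xi>"] by (simp add: power2_sum power2_diff)
    also have "\<dots> \<le> 2 * (t * L)\<^sup>2 + 2 * (norm \<xi>)\<^sup>2"
      using power_mono[OF norm_a_le norm_ge_zero, of 2] by linarith
    finally show "(norm (- a + \<xi>))\<^sup>2 \<le> 2 * (t * L)\<^sup>2 + 2 * (norm \<xi>)\<^sup>2" .
  qed
  also have "\<dots> = ennreal (\<integral>\<xi>. 2 * (t * L)\<^sup>2 + 2 * (norm \<xi>)\<^sup>2 \<partial>\<gamma>)"
    by (rule nn_integral_eq_integral) (use sq(1) in auto)
  also have "\<dots> \<le> ennreal C"
    using sq by (intro ennreal_leI) (simp add: C_def)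
  finally have shifted: "(\<integral>\<^sup>+\<xi>. ennreal ((norm (- a + \<xi>))\<^sup>2) \<partial>\<gamma>) \<le> ennreal C" .
  have "(\<integral>\<^sup>+\<xi>. ennreal ((norm (w \<xi> *\<^sub>R (a + \<xi>)))\<^sup>2) \<partial>\<gamma>)
      \<le> ennreal a1 * (\<integral>\<^sup>+\<xi>. ennreal ((norm (- a + \<xi>))\<^sup>2) \<partial>\<gamma>)"
    unfolding eq by (rule nn_integral_w_square_le) auto
  also have "\<dots> \<le> ennreal a1 * ennreal C" by (rule mult_left_mono[OF shifted]) simp
  also have "\<dots> = ennreal (a1 * C)" by (rule ennreal_mult'[symmetric]) (simp add: a1_def)
  finally have le: "(\<integral>\<^sup>+\<xi>. ennreal ((norm (w \<xi> *\<^sub>R (a + \<xi>)))\<^sup>2) \<partial>\<gamma>) \<le> ennreal (a1 * C)" .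
  show "integrable \<gamma> (\<lambda>\<xi>. (norm (w \<xi> *\<^sub>R (a + \<xi>)))\<^sup>2)"
    "(\<integral>\<xi>. (norm (w \<xi> *\<^sub>R (a + \<xi>)))\<^sup>2 \<partial>\<gamma>) \<le> a1 * (2 * (t * L)\<^sup>2 + 2 * K)"
    unfolding C_def[symmetric]
    by (rule integrable_nn_integral_le[OF meas zero_le_power2 le aC])+
qed

end

subsection \<open>Conditional error of the estimator\<close>

lemma measurable_prox:
  fixes F :: "'a::euclidean_space \<Rightarrow> real"
  assumes "convex_on UNIV F" "L-lipschitz_on UNIV F" "t > 0"
  shows "prox t F \<in> borel_measurable borel"
  by (intro borel_measurable_continuous_onI firmly_nonexpansive_imp_continuous
      firmly_nonexpansive_prox[OF assms])

lemma measurable_prox_estimator: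
  fixes F :: "real^'n \<Rightarrow> real"
  assumes [measurable]: "F \<in> borel_measurable borel"
    and Z [measurable]: "\<And>i. i \<in> {1..N} \<Longrightarrow> Z i \<in> borel_measurable A"
  shows "(\<lambda>\<omega>. prox_estimator F \<delta> N (\<lambda>i. Z i \<omega>)) \<in> borel_measurable A"
  unfolding prox_estimator_def by measurable

context proximal_weights
begin

text \<open>The normalized weights add up to 1, so \<open>p\<close> can be subtracted from every
  sample.\<close>

lemma prox_estimator_eq:
  assumes N: "N > 0"
  shows "prox_estimator F \<delta> N (\<lambda>i. c + x i) - p
    = (\<Sum>i=1..N. w (x i) *\<^sub>R (a + x i)) /\<^sub>R (\<Sum>i=1..N. w (x i))"
proof -
  define s where "s = (\<Sum>i=1..N. w (x i))"
  have s: "s > 0" unfolding s_def w_def using N by (intro sum_pos) auto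
  define A where "A = (\<Sum>i=1..N. w (x i) *\<^sub>R (a + x i))"
  have "(\<Sum>i=1..N. w (x i) *\<^sub>R (c + x i)) = A + s *\<^sub>R p"
    unfolding A_def s_def scaleR_sum_left sum.distrib[symmetric]
    by (simp add: a_def flip: scaleR_add_right)
  then have "prox_estimator F \<delta> N (\<lambda>i. c + x i) = (A + s *\<^sub>R p) /\<^sub>R s"
    by (simp only: prox_estimator_def w_def s_def)
  then show ?thesis
    using s unfolding A_def[symmetric] s_def[symmetric] by (simp add: scaleR_add_right)
qed

text \<open>The tolerance \<open>\<epsilon>\<close> is such that the numerator contributes exactly
  \<open>exp (4 * k) * (1 + k) * \<alpha> / 4\<close> to the failure probability, while
  \<open>N_ge\<close> limits the denominator to \<open>exp (4 * k) * \<alpha> / 2\<close>. The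
  prefactor \<open>2 * (1 + sqrt k)\<close> covers \<open>2 * \<epsilon>\<close> and the bias term
  \<open>2 * sqrt K\<close>.\<close>

lemma prox_estimator_concentration:
  fixes \<alpha> :: real
  defines "k \<equiv> 8 / 3 * 2 ^ CARD('n)"
    and "J \<equiv> exp (2 / \<delta> * L\<^sup>2 * t)"
    and "B \<equiv> real CARD('n) * t * \<delta> + (2 * sqrt (real CARD('n) * t * \<delta>) + 3 * L * t)\<^sup>2"
  assumes N: "N > 0" and \<alpha>: "\<alpha> > 0" and N_ge: "real N \<ge> 8 * J / \<alpha>"
  shows "measure (PiM {1..N} (\<lambda>_. \<gamma>)) {x \<in> space (PiM {1..N} (\<lambda>_. \<gamma>)).
      2 * (1 + sqrt k) * (sqrt (8 * J * B / (\<alpha> * real N)) + sqrt (real CARD('n) * t * \<delta>))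
        < norm (prox_estimator F \<delta> N (\<lambda>i. c + x i) - p)} \<le> exp (4 * k) * (1 + k) * \<alpha>"
proof -
  let ?P = "PiM {1..N} (\<lambda>_. \<gamma>)"
  interpret P: prob_space ?P by (intro prob_space_PiM prob_space_\<gamma>)
  define e where "e = sqrt (real CARD('n) * t * \<delta>)"
  define \<epsilon> where "\<epsilon> = sqrt (8 * J * B / (\<alpha> * real N))"
  define \<rho> where "\<rho> = 2 * (1 + sqrt k) * (\<epsilon> + e)"
  have k: "k > 0" and J: "J > 0" by (auto simp: k_def J_def)
  have Kk: "K = k * (\<delta> * t)" by (simp add: K_def k_def)
  have n: "real CARD('n) \<ge> 1" by (simp add: Suc_le_eq)
  have tn: "t * \<delta> \<le> real CARD('n) * t * \<delta>"
    using mult_right_mono[OF n, of "t * \<delta>"] t \<delta> by (simp add: mult.assoc)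
  have e: "e \<ge> 0" using t \<delta> by (simp add: e_def)
  have B_eq: "B = real CARD('n) * t * \<delta> + (2 * e + 3 * L * t)\<^sup>2" by (simp add: B_def e_def)
  have "(t * L)\<^sup>2 \<le> (2 * e + 3 * L * t)\<^sup>2"
  proof (rule power_mono)
    have "t * L \<le> 3 * L * t" using L_nonneg t by simp
    then show "t * L \<le> 2 * e + 3 * L * t" using e by linarith
  qed (use L_nonneg t in simp)
  \<comment> \<open>Of the large square in \<open>B\<close> only \<open>(t * L)\<^sup>2\<close> is
    kept, which bounds the squared distance of the centre from \<open>p\<close>; the other summand
    dominates the variance \<open>t * \<delta>\<close>.\<close>
  then have B_ge: "t * \<delta> + (t * L)\<^sup>2 \<le> B" unfolding B_eq using tn by linarith
  have B: "B > 0" using B_ge mult_pos_pos[OF t \<delta>] zero_le_power2[of "t * L"] by linarith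
  have \<epsilon>: "\<epsilon> > 0" "\<epsilon>\<^sup>2 = 8 * J * B / (\<alpha> * real N)"
    using J B \<alpha> N by (auto simp: \<epsilon>_def)
  have w_le: "(\<integral>y. (w y)\<^sup>2 \<partial>\<gamma>) \<le> (exp (4 * k) * J) * V\<^sup>2"
    using integral_w_square_le(2) a1_le by (simp add: k_def J_def)
  have C: "2 * (t * L)\<^sup>2 + 2 * K \<le> 2 * (1 + k) * B"
  proof -
    have "2 * (t * L)\<^sup>2 + 2 * K \<le> 2 * (1 + k) * (t * \<delta> + (t * L)\<^sup>2)"
      using k mult_pos_pos[OF t \<delta>] by (simp add: Kk algebra_simps)
    also have "\<dots> \<le> 2 * (1 + k) * B" using k by (intro mult_left_mono[OF B_ge]) auto
    finally show ?thesis .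
  qed
  have wd_le: "(\<integral>y. (norm (w y *\<^sub>R (a + y)))\<^sup>2 \<partial>\<gamma>) \<le> (exp (4 * k) * J * (2 * (1 + k) * B)) * V\<^sup>2"
  proof -
    have "(\<integral>y. (norm (w y *\<^sub>R (a + y)))\<^sup>2 \<partial>\<gamma>) \<le> a1 * (2 * (t * L)\<^sup>2 + 2 * K)"
      by (rule integral_norm_w_square_le(2))
    also have "\<dots> \<le> (exp (4 * k) * J * V\<^sup>2) * (2 * (1 + k) * B)"
      using a1_le C K_pos by (intro mult_mono) (auto simp: k_def J_def)
    finally show ?thesis by (simp only: mult_ac)
  qed
  have "sqrt K = sqrt k * sqrt (t * \<delta>)" by (simp add: Kk real_sqrt_mult mult.commute)
  also have "\<dots> \<le> sqrt k * e"
    unfolding e_def using tn k by (intro mult_left_mono real_sqrt_le_mono) auto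
  finally have "2 * \<epsilon> + 2 * sqrt K \<le> 2 * \<epsilon> + 2 * (sqrt k * e)" by simp
  also have "\<dots> \<le> \<rho>"
    using k \<epsilon> e by (simp add: \<rho>_def algebra_simps)
  finally have le: "2 * \<epsilon> + 2 * sqrt K \<le> \<rho>" .
  have meas: "w \<in> borel_measurable \<gamma>" "(\<lambda>y. a + y) \<in> borel_measurable \<gamma>" by measurable
  have coord [measurable]: "(\<lambda>x. w (x i)) \<in> borel_measurable ?P" "(\<lambda>x. x i) \<in> measurable ?P borel"
    if "i \<in> {1..N}" for i using that by measurable
  have "measure ?P {x \<in> space ?P. \<rho> < norm (prox_estimator F \<delta> N (\<lambda>i. c + x i) - p)}
      \<le> measure ?P {x \<in> space ?P. 2 * \<epsilon> + 2 * sqrt K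
        < norm ((\<Sum>i=1..N. w (x i) *\<^sub>R (a + x i)) /\<^sub>R (\<Sum>i=1..N. w (x i)))}"
    unfolding prox_estimator_eq[OF N]
  proof (rule P.finite_measure_mono)
    show "{x \<in> space ?P. 2 * \<epsilon> + 2 * sqrt K
        < norm ((\<Sum>i=1..N. w (x i) *\<^sub>R (a + x i)) /\<^sub>R (\<Sum>i=1..N. w (x i)))} \<in> sets ?P"
      by measurable
  qed (use le in auto)
  also have "\<dots> \<le> 4 * (exp (4 * k) * J) / real (card {1..N})
      + exp (4 * k) * J * (2 * (1 + k) * B) / (real (card {1..N}) * \<epsilon>\<^sup>2)"
    by (rule self_normalized_average_concentration[OF prob_space_\<gamma> _ _ meas integral_w_square_le(1)
          integral_norm_w_square_le(1) V_def V_pos w_le wd_le norm_bias_le \<epsilon>(1)])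
      (use N in auto)
  also have "\<dots> = 4 * exp (4 * k) * (J / real N) + exp (4 * k) * (1 + k) * \<alpha> / 4"
    using N \<alpha> J B by (simp add: \<epsilon>(2) field_simps)
  also have "\<dots> \<le> 4 * exp (4 * k) * (\<alpha> / 8) + exp (4 * k) * (1 + k) * \<alpha> / 4"
  proof -
    have "J / real N \<le> \<alpha> / 8" using N_ge \<alpha> N by (simp add: field_simps)
    then show ?thesis by (intro add_right_mono mult_left_mono) auto
  qed
  also have "\<dots> \<le> exp (4 * k) * (1 + k) * \<alpha>"
  proof -
    have "0 < exp (4 * k) * \<alpha>" "0 < exp (4 * k) * k * \<alpha>" using \<alpha> k by auto
    moreover have "4 * exp (4 * k) * (\<alpha> / 8) + exp (4 * k) * (1 + k) * \<alpha> / 4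
        = 3 / 4 * (exp (4 * k) * \<alpha>) + 1 / 4 * (exp (4 * k) * k * \<alpha>)" by (simp add: field_simps)
    moreover have "exp (4 * k) * (1 + k) * \<alpha> = exp (4 * k) * \<alpha> + exp (4 * k) * k * \<alpha>"
      by (simp add: field_simps)
    ultimately show ?thesis by linarith
  qed
  finally show ?thesis by (simp add: \<rho>_def \<epsilon>_def e_def)
qed

end

text \<open>The random centre is stored as coordinate \<open>0\<close> next to the samples \<open>1, \<dots>, N\<close>, so that the
  joint law is determined by its values on boxes.\<close>

lemma cond_iid_gaussian_prob_le:
  fixes C :: "'w \<Rightarrow> real^'n"
  assumes M: "prob_space M" and G: "subalgebra M G" and C: "C \<in> borel_measurable G"
    and v: "v > 0" and law: "cond_iid_gaussian M G C v N Z"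
    and E: "E \<in> sets (PiM {0..N} (\<lambda>_. borel))"
    and bound: "\<And>c. measure (PiM {1..N} (\<lambda>_. isotropic_gaussian (0::real^'n) v))
        {\<xi> \<in> space (PiM {1..N} (\<lambda>_. isotropic_gaussian (0::real^'n) v)).
          (\<lambda>i\<in>{0..N}. if i = 0 then c else c + \<xi> i) \<in> E} \<le> \<beta>"
  shows "measure M {\<omega> \<in> space M. (\<lambda>i\<in>{0..N}. if i = 0 then C \<omega> else Z i \<omega>) \<in> E} \<le> \<beta>"
proof -
  interpret M: prob_space M by fact
  interpret G: finite_measure_subalgebra M G by standard (rule G)
  let ?\<gamma> = "isotropic_gaussian (0::real^'n) v"
  have \<gamma>: "prob_space ?\<gamma>" by (rule prob_space_isotropic_gaussian[OF v])
  interpret \<gamma>: prob_space ?\<gamma> by fact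
  let ?P = "PiM {1..N} (\<lambda>_. ?\<gamma>)"
  let ?S = "PiM {0..N} (\<lambda>_. borel :: (real^'n) measure)"
  interpret P: prob_space ?P by (intro prob_space_PiM \<gamma>)
  interpret \<gamma>s: product_sigma_finite "\<lambda>_::nat. ?\<gamma>" by standard
  have [measurable]: "C \<in> borel_measurable M" using measurable_from_subalg[OF G C] .
  have [measurable]: "Z i \<in> borel_measurable M" if "i \<in> {1..N}" for i
    using law that by (auto simp: cond_iid_gaussian_def)
  \<comment> \<open>\<open>X\<close> records the actual centre and samples. \<open>T\<close> is an
    idealized copy on a product space, with noise \<open>\<xi>\<close> independent of
    \<open>\<omega>\<close>. Once their laws agree, Fubini reduces the claim to fixed
    centres.\<close>
  define X where "X \<omega> = (\<lambda>i\<in>{0..N}. if i = 0 then C \<omega> else Z i \<omega>)" for \<omega>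
  define T where "T = (\<lambda>(\<omega>, \<xi>). \<lambda>i\<in>{0..N}. if i = 0 then C \<omega> else C \<omega> + \<xi> i)"
  have X [measurable]: "X \<in> measurable M ?S"
    unfolding X_def
  proof (rule measurable_restrict)
    fix i assume "i \<in> {0..N}"
    then show "(\<lambda>\<omega>. if i = 0 then C \<omega> else Z i \<omega>) \<in> borel_measurable M" by (cases "i = 0") auto
  qed
  have T [measurable]: "T \<in> measurable (M \<Otimes>\<^sub>M ?P) ?S"
    unfolding T_def case_prod_beta
  proof (rule measurable_restrict)
    fix i assume i: "i \<in> {0..N}"
    show "(\<lambda>y. if i = 0 then C (fst y) else C (fst y) + snd y i) \<in> borel_measurable (M \<Otimes>\<^sub>M ?P)"
    proof (cases "i = 0")
      case False
      then have "i \<in> {1..N}" using i by auto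
      then have "(\<lambda>\<xi>. \<xi> i) \<in> measurable ?P borel" by measurable
      then show ?thesis using False by simp
    qed simp
  qed
  have "distr M ?S X = distr (M \<Otimes>\<^sub>M ?P) ?S T"
  proof (rule measure_eqI_PiM_finite)
    show "range (\<lambda>_::nat. \<Pi>\<^sub>E i\<in>{0..N}. UNIV) \<subseteq> prod_algebra {0..N} (\<lambda>_. borel :: (real^'n) measure)"
      by (auto intro!: prod_algebraI_finite)
    show "(\<Union>i::nat. \<Pi>\<^sub>E i\<in>{0..N}. UNIV) = space ?S" by (simp add: space_PiM)
    show "emeasure (distr M ?S X) (\<Pi>\<^sub>E i\<in>{0..N}. UNIV) \<noteq> \<infinity>"
      by (simp add: emeasure_distr)
    fix A :: "nat \<Rightarrow> (real^'n) set"
    assume A: "\<And>i. i \<in> {0..N} \<Longrightarrow> A i \<in> sets borel"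
    have box: "Pi\<^sub>E {0..N} A \<in> sets ?S" using A by (intro sets_PiM_I_finite) auto
    \<comment> \<open>The box event splits into \<open>A0\<close>, which lies in \<open>G\<close>
      because the centre is \<open>G\<close>-measurable, and \<open>H\<close>, whose conditional
      probability is prescribed. Integrating over \<open>A0\<close>, the indicator of
      \<open>H\<close> may therefore be replaced by its conditional expectation.\<close>
    define A0 where "A0 = C -` A 0 \<inter> space M"
    have A0: "A0 \<in> sets G"
      unfolding A0_def using measurable_sets[OF C A[of 0]] G by (simp add: subalgebra_def)
    have A0M [measurable]: "A0 \<in> sets M" using A0 G by (auto simp: subalgebra_def)
    define H where "H = {\<omega> \<in> space M. \<forall>i\<in>{1..N}. Z i \<omega> \<in> A i}"
    have H [measurable]: "H \<in> sets M"
      unfolding H_def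
    proof (intro sets.sets_Collect_finite_All)
      fix i assume i: "i \<in> {1..N}"
      then have [measurable]: "A i \<in> sets borel" using A by auto
      show "{\<omega> \<in> space M. Z i \<omega> \<in> A i} \<in> sets M" using i by measurable
    qed simp
    have HC: "AE \<omega> in M. real_cond_exp M G (indicator H) \<omega> = (\<Prod>i=1..N. measure (isotropic_gaussian (C \<omega>) v) (A i))"
      using law A unfolding cond_iid_gaussian_def H_def by auto
    have intH: "integrable M (indicator H :: 'w \<Rightarrow> real)"
      by (rule integrable_real_indicator[OF H]) (simp add: M.emeasure_eq_measure)
    have inter: "X -` Pi\<^sub>E {0..N} A \<inter> space M = A0 \<inter> H"
    proof -
      have "{0..N} = insert 0 {1..N}" by auto
      then show ?thesis by (auto simp: X_def A0_def H_def PiE_iff)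
    qed
    \<comment> \<open>The fibre over \<open>\<omega>\<close> is a box of translated sets, or empty
      when the centre misses \<open>A 0\<close>; its product measure is the product in the
      conditional law.\<close>
    have slice: "emeasure ?P (Pair \<omega> -` (T -` Pi\<^sub>E {0..N} A \<inter> space (M \<Otimes>\<^sub>M ?P)))
        = ennreal (indicator A0 \<omega> * (\<Prod>i=1..N. measure (isotropic_gaussian (C \<omega>) v) (A i)))"
      if \<omega>: "\<omega> \<in> space M" for \<omega>
    proof (cases "\<omega> \<in> A0")
      case True
      have "Pair \<omega> -` (T -` Pi\<^sub>E {0..N} A \<inter> space (M \<Otimes>\<^sub>M ?P))
          = Pi\<^sub>E {1..N} (\<lambda>i. (\<lambda>y. C \<omega> + y) -` A i)"
      proof -
        have "{0..N} = insert 0 {1..N}" by auto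
        then show ?thesis using True \<omega>
          by (auto simp: T_def A0_def PiE_iff space_pair_measure space_PiM extensional_def)
      qed
      also have "emeasure ?P \<dots> = (\<Prod>i=1..N. emeasure ?\<gamma> ((\<lambda>y. C \<omega> + y) -` A i))"
      proof (rule \<gamma>s.emeasure_PiM)
        fix i assume "i \<in> {1..N}"
        then have "A i \<in> sets borel" using A by auto
        then have "(\<lambda>y. C \<omega> + y) -` A i \<inter> space borel \<in> sets borel"
          by (rule measurable_sets[rotated]) measurable
        then show "(\<lambda>y. C \<omega> + y) -` A i \<in> sets ?\<gamma>" by simp
      qed simp
      also have "\<dots> = (\<Prod>i=1..N. ennreal (measure (isotropic_gaussian (C \<omega>) v) (A i)))"
      proof (rule prod.cong[OF refl])
        fix i assume i: "i \<in> {1..N}"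
        have "emeasure ?\<gamma> ((\<lambda>y. C \<omega> + y) -` A i) = emeasure (isotropic_gaussian (C \<omega>) v) (A i)"
          using A[of i] i by (subst (2) isotropic_gaussian_shift) (simp add: emeasure_distr)
        also have "\<dots> = ennreal (measure (isotropic_gaussian (C \<omega>) v) (A i))"
          by (rule finite_measure.emeasure_eq_measure[OF prob_space.finite_measure])
            (rule prob_space_isotropic_gaussian[OF v])
        finally show "emeasure ?\<gamma> ((\<lambda>y. C \<omega> + y) -` A i) = \<dots>" .
      qed
      finally show ?thesis using True by (simp add: prod_ennreal)
    next
      case False
      have "Pair \<omega> -` (T -` Pi\<^sub>E {0..N} A \<inter> space (M \<Otimes>\<^sub>M ?P)) = {}"
      proof -
        have "T (\<omega>, \<xi>) \<notin> Pi\<^sub>E {0..N} A" for \<xi>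
        proof
          assume "T (\<omega>, \<xi>) \<in> Pi\<^sub>E {0..N} A"
          then have "T (\<omega>, \<xi>) 0 \<in> A 0" by auto
          then show False using False \<omega> by (simp add: T_def A0_def)
        qed
        then show ?thesis by auto
      qed
      then show ?thesis using False by simp
    qed
    have "emeasure (distr M ?S X) (Pi\<^sub>E {0..N} A) = emeasure M (A0 \<inter> H)"
      using box by (simp add: emeasure_distr inter)
    also have "\<dots> = ennreal (\<integral>\<omega>. indicator A0 \<omega> * indicator H \<omega> \<partial>M)"
      by (simp add: M.emeasure_eq_measure indicator_inter_arith[symmetric])
    also have "(\<integral>\<omega>. indicator A0 \<omega> * indicator H \<omega> \<partial>M)
        = (\<integral>\<omega>. indicator A0 \<omega> * real_cond_exp M G (indicator H) \<omega> \<partial>M)"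
      using G.real_cond_exp_intA[OF intH A0] by (simp add: set_lebesgue_integral_def)
    also have "ennreal \<dots> = (\<integral>\<^sup>+\<omega>. ennreal (indicator A0 \<omega> * real_cond_exp M G (indicator H) \<omega>) \<partial>M)"
    proof (rule nn_integral_eq_integral[symmetric])
      show "integrable M (\<lambda>\<omega>. indicator A0 \<omega> * real_cond_exp M G (indicator H) \<omega>)"
        using integrable_mult_indicator[OF A0M G.real_cond_exp_int(1)[OF intH]] by simp
      show "AE \<omega> in M. 0 \<le> indicator A0 \<omega> * real_cond_exp M G (indicator H) \<omega>"
        using HC by eventually_elim (simp add: prod_nonneg)
    qed
    also have "\<dots> = (\<integral>\<^sup>+\<omega>. emeasure ?P (Pair \<omega> -` (T -` Pi\<^sub>E {0..N} A \<inter> space (M \<Otimes>\<^sub>M ?P))) \<partial>M)"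
    proof (rule nn_integral_cong_AE)
      show "AE \<omega> in M. ennreal (indicator A0 \<omega> * real_cond_exp M G (indicator H) \<omega>)
          = emeasure ?P (Pair \<omega> -` (T -` Pi\<^sub>E {0..N} A \<inter> space (M \<Otimes>\<^sub>M ?P)))"
        using HC AE_space by eventually_elim (simp only: slice)
    qed
    also have "\<dots> = emeasure (M \<Otimes>\<^sub>M ?P) (T -` Pi\<^sub>E {0..N} A \<inter> space (M \<Otimes>\<^sub>M ?P))"
      using measurable_sets[OF T box] by (rule P.emeasure_pair_measure_alt[symmetric])
    also have "\<dots> = emeasure (distr (M \<Otimes>\<^sub>M ?P) ?S T) (Pi\<^sub>E {0..N} A)"
      by (rule emeasure_distr[OF T box, symmetric])
    finally show "emeasure (distr M ?S X) (Pi\<^sub>E {0..N} A) = emeasure (distr (M \<Otimes>\<^sub>M ?P) ?S T) (Pi\<^sub>E {0..N} A)" .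
  qed auto
  then have "emeasure (distr M ?S X) E = emeasure (distr (M \<Otimes>\<^sub>M ?P) ?S T) E" by simp
  also have "\<dots> = emeasure (M \<Otimes>\<^sub>M ?P) (T -` E \<inter> space (M \<Otimes>\<^sub>M ?P))"
    by (rule emeasure_distr[OF T E])
  also have "\<dots> = (\<integral>\<^sup>+\<omega>. emeasure ?P (Pair \<omega> -` (T -` E \<inter> space (M \<Otimes>\<^sub>M ?P))) \<partial>M)"
    using measurable_sets[OF T E] by (rule P.emeasure_pair_measure_alt)
  \<comment> \<open>Uniformity in the centre is used here: \<open>bound\<close> applies on each
    fibre with \<open>c = C \<omega>\<close>.\<close>
  also have "\<dots> \<le> (\<integral>\<^sup>+\<omega>. ennreal \<beta> \<partial>M)"
  proof (rule nn_integral_mono)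
    fix \<omega> assume "\<omega> \<in> space M"
    then have "Pair \<omega> -` (T -` E \<inter> space (M \<Otimes>\<^sub>M ?P))
        = {\<xi> \<in> space ?P. (\<lambda>i\<in>{0..N}. if i = 0 then C \<omega> else C \<omega> + \<xi> i) \<in> E}"
      by (auto simp: T_def space_pair_measure)
    then show "emeasure ?P (Pair \<omega> -` (T -` E \<inter> space (M \<Otimes>\<^sub>M ?P))) \<le> ennreal \<beta>"
      using bound[of "C \<omega>"] by (simp only: P.emeasure_eq_measure ennreal_leI)
  qed
  also have "\<dots> = ennreal \<beta>" by (simp add: M.emeasure_space_1)
  finally have "emeasure (distr M ?S X) E \<le> ennreal \<beta>" .
  moreover have "emeasure (distr M ?S X) E = ennreal (measure M {\<omega> \<in> space M. X \<omega> \<in> E})"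
    unfolding emeasure_distr[OF X E] by (simp add: M.emeasure_eq_measure vimage_def Int_def conj_commute)
  moreover have "\<beta> \<ge> 0" using bound[of 0] measure_nonneg order_trans by blast
  ultimately show ?thesis by (simp add: X_def ennreal_le_iff)
qed

text \<open>The error event is a measurable set of vectors with the centre in coordinate 0. The
  estimator reads only the coordinates from 1 on, so it is unaffected by that extra entry.\<close>

lemma prox_estimator_error_prob:
  fixes F :: "real^'n \<Rightarrow> real" and C :: "'w \<Rightarrow> real^'n" and \<alpha> :: real
  defines "k \<equiv> 8 / 3 * 2 ^ CARD('n)"
  assumes F: "convex_on UNIV F" "L-lipschitz_on UNIV F" and t: "t > 0" and \<delta>: "\<delta> > 0"
    and N: "N > 0" and \<alpha>: "\<alpha> > 0"
    and J: "J = exp (2 / \<delta> * L\<^sup>2 * t)"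
    and B: "B = real CARD('n) * t * \<delta> + (2 * sqrt (real CARD('n) * t * \<delta>) + 3 * L * t)\<^sup>2"
    and N_ge: "real N \<ge> 8 * J / \<alpha>"
    and M: "prob_space M" and G: "subalgebra M G" and C: "C \<in> borel_measurable G"
    and law: "cond_iid_gaussian M G C (\<delta> * t) N Z"
  shows "measure M {\<omega> \<in> space M.
      2 * (1 + sqrt k) * (sqrt (8 * J * B / (\<alpha> * real N)) + sqrt (real CARD('n) * t * \<delta>))
        < norm (prox_estimator F \<delta> N (\<lambda>i. Z i \<omega>) - prox t F (C \<omega>))}
    \<le> exp (4 * k) * (1 + k) * \<alpha>"
proof -
  define \<rho> where "\<rho> = 2 * (1 + sqrt k) * (sqrt (8 * J * B / (\<alpha> * real N)) + sqrt (real CARD('n) * t * \<delta>))"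
  let ?S = "PiM {0..N} (\<lambda>_. borel :: (real^'n) measure)"
  have [measurable]: "F \<in> borel_measurable borel"
    using lipschitz_on_continuous_on[OF F(2)] by (rule borel_measurable_continuous_onI)
  note [measurable] = measurable_prox[OF F t]
  have est [measurable]: "(\<lambda>y. prox_estimator F \<delta> N (\<lambda>i. y i)) \<in> borel_measurable ?S"
    by (rule measurable_prox_estimator) auto
  define E where "E = {y \<in> space ?S. \<rho> < norm (prox_estimator F \<delta> N (\<lambda>i. y i) - prox t F (y 0))}"
  have E: "E \<in> sets ?S" unfolding E_def by measurable
  have cong: "prox_estimator F \<delta> N y = prox_estimator F \<delta> N y'"
    if "\<And>i. i \<in> {1..N} \<Longrightarrow> y i = y' i" for y y' :: "nat \<Rightarrow> real^'n"
  proof -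
    have "(\<Sum>i=1..N. exp (- F (y i) / \<delta>) *\<^sub>R y i) = (\<Sum>i=1..N. exp (- F (y' i) / \<delta>) *\<^sub>R y' i)"
      "(\<Sum>i=1..N. exp (- F (y i) / \<delta>)) = (\<Sum>i=1..N. exp (- F (y' i) / \<delta>))"
      by (auto intro!: sum.cong simp: that)
    then show ?thesis by (simp only: prox_estimator_def)
  qed
  have in_E: "(\<lambda>i\<in>{0..N}. if i = 0 then c else y i) \<in> E
      \<longleftrightarrow> \<rho> < norm (prox_estimator F \<delta> N y - prox t F c)" for c y
  proof -
    have "prox_estimator F \<delta> N (\<lambda>i\<in>{0..N}. if i = 0 then c else y i) = prox_estimator F \<delta> N y"
      by (rule cong) auto
    then show ?thesis by (simp add: E_def space_PiM)
  qed
  have "measure M {\<omega> \<in> space M. (\<lambda>i\<in>{0..N}. if i = 0 then C \<omega> else Z i \<omega>) \<in> E} \<le> exp (4 * k) * (1 + k) * \<alpha>"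
  proof (rule cond_iid_gaussian_prob_le[OF M G C _ law E])
    show "\<delta> * t > 0" using \<delta> t by simp
    fix c :: "real^'n"
    interpret proximal_weights F L t \<delta> c by standard (use F t \<delta> in auto)
    show "measure (PiM {1..N} (\<lambda>_. isotropic_gaussian (0::real^'n) (\<delta> * t)))
        {\<xi> \<in> space (PiM {1..N} (\<lambda>_. isotropic_gaussian (0::real^'n) (\<delta> * t))).
          (\<lambda>i\<in>{0..N}. if i = 0 then c else c + \<xi> i) \<in> E} \<le> exp (4 * k) * (1 + k) * \<alpha>"
      using prox_estimator_concentration[OF N \<alpha> N_ge[unfolded J]]
      unfolding in_E \<rho>_def J B k_def p_def .
  qed
  then show ?thesis unfolding in_E by (simp only: \<rho>_def)
qed

section \<open>Past information and the almost sure conclusion\<close>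

lemma
  assumes S: "\<And>X. X \<in> S \<Longrightarrow> X \<in> borel_measurable M"
  shows subalgebra_generated_algebra: "subalgebra M (generated_algebra M S)"
    and measurable_generated_algebra: "X \<in> S \<Longrightarrow> X \<in> borel_measurable (generated_algebra M S)"
proof -
  let ?G = "{X -` A \<inter> space M | X A. X \<in> S \<and> A \<in> sets borel}"
  have pow: "?G \<subseteq> Pow (space M)" by auto
  have sub: "?G \<subseteq> sets M" using S by (auto intro: measurable_sets)
  have sets: "sets (generated_algebra M S) = sigma_sets (space M) ?G"
    and space: "space (generated_algebra M S) = space M"
    unfolding generated_algebra_def using pow by (simp_all add: sets_measure_of)
  show "subalgebra M (generated_algebra M S)"
    unfolding subalgebra_def sets space using sets.sigma_sets_subset[OF sub] by simp
  show "X \<in> borel_measurable (generated_algebra M S)" if X: "X \<in> S"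
  proof (rule measurableI)
    fix A :: "'b set" assume "A \<in> sets borel"
    then show "X -` A \<inter> space (generated_algebra M S) \<in> sets (generated_algebra M S)"
      unfolding sets space using X by (intro sigma_sets.Basic) blast
  qed simp
qed

lemma space_generated_algebra [simp]: "space (generated_algebra M S) = space M"
  unfolding generated_algebra_def by (rule space_measure_of) auto

lemma measurable_generated_algebra_mono:
  assumes "S \<subseteq> T" "h \<in> measurable (generated_algebra M S) N"
  shows "h \<in> measurable (generated_algebra M T) N"
proof (rule measurable_from_subalg[OF _ assms(2)])
  have "sets (generated_algebra M S) \<subseteq> sets (generated_algebra M T)"
    unfolding generated_algebra_def
    by (subst (1 2) sets_measure_of) (use assms(1) in \<open>auto intro!: sigma_sets_mono'\<close>)
  then show "subalgebra (generated_algebra M T) (generated_algebra M S)"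
    by (simp add: subalgebra_def)
qed

theorem theorem3p8:
  fixes f g :: "real^'n \<Rightarrow> real"
    and L t :: real
    and \<delta> \<alpha> J B :: "nat \<Rightarrow> real"
    and N :: "nat \<Rightarrow> nat"
    and M :: "'w measure"
    and Y W :: "nat \<Rightarrow> nat \<Rightarrow> 'w \<Rightarrow> real^'n"
    and x xhalf z :: "nat \<Rightarrow> 'w \<Rightarrow> real^'n"
    and z1 :: "real^'n"
  assumes f: "proper_fun (\<lambda>u. ereal (f u))" "convex_on UNIV f"
      "lower_semicontinuous (\<lambda>u. ereal (f u))" "lipschitz_on L UNIV f"
    and g: "proper_fun (\<lambda>u. ereal (g u))" "convex_on UNIV g"
      "lower_semicontinuous (\<lambda>u. ereal (g u))" "lipschitz_on L UNIV g"
    and argmin: "{u. is_arg_min (\<lambda>u. f u + g u) (\<lambda>_. True) u} \<noteq> {}"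
    and t: "t > 0"
    and N_pos: "\<And>k. k \<ge> 1 \<Longrightarrow> N k > 0"
    and delta_pos: "\<And>k. k \<ge> 1 \<Longrightarrow> \<delta> k > 0"
    and alpha: "\<And>k. k \<ge> 1 \<Longrightarrow> \<alpha> k \<in> {0<..<1}"
    and delta_sum: "summable (\<lambda>k. sqrt (\<delta> (Suc k)))"
    and alpha_sum: "summable (\<lambda>k. \<alpha> (Suc k))"
    and J: "\<And>k. k \<ge> 1 \<Longrightarrow> J k = exp (2 / \<delta> k * L\<^sup>2 * t)"
    and B: "\<And>k. k \<ge> 1 \<Longrightarrow> B k = real CARD('n) * t * \<delta> k
                + (2 * sqrt (real CARD('n) * t * \<delta> k) + 3 * L * t)\<^sup>2"
    and N_ge: "\<And>k. k \<ge> 1 \<Longrightarrow> real (N k) \<ge> 8 * J k / \<alpha> k"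
    and err_sum: "summable (\<lambda>k. sqrt (8 * J (Suc k) * B (Suc k) / (\<alpha> (Suc k) * real (N (Suc k))))
                + sqrt (real CARD('n) * t * \<delta> (Suc k)))"
    and M: "prob_space M"
    and z_init: "\<And>\<omega>. \<omega> \<in> space M \<Longrightarrow> z 1 \<omega> = z1"
    and Y_law: "\<And>k. k \<ge> 1 \<Longrightarrow>
        cond_iid_gaussian M (generated_algebra M (samples_before N Y W k))
          (z k) (\<delta> k * t) (N k) (Y k)"
    and xhalf_step: "\<And>k \<omega>. k \<ge> 1 \<Longrightarrow> \<omega> \<in> space M \<Longrightarrow>
        xhalf k \<omega> = prox_estimator f (\<delta> k) (N k) (\<lambda>i. Y k i \<omega>)"
    and W_law: "\<And>k. k \<ge> 1 \<Longrightarrow>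
        cond_iid_gaussian M (generated_algebra M (samples_before N Y W k \<union> Y k ` {1..N k}))
          (\<lambda>\<omega>. 2 *\<^sub>R xhalf k \<omega> - z k \<omega>) (\<delta> k * t) (N k) (W k)"
    and x_step: "\<And>k \<omega>. k \<ge> 1 \<Longrightarrow> \<omega> \<in> space M \<Longrightarrow>
        x (Suc k) \<omega> = prox_estimator g (\<delta> k) (N k) (\<lambda>i. W k i \<omega>)"
    and z_step: "\<And>k \<omega>. k \<ge> 1 \<Longrightarrow> \<omega> \<in> space M \<Longrightarrow>
        z (Suc k) \<omega> = z k \<omega> + x (Suc k) \<omega> - xhalf k \<omega>"
  shows "AE \<omega> in M. \<exists>xstar. is_arg_min (\<lambda>u. f u + g u) (\<lambda>_. True) xstar
           \<and> (\<lambda>k. x k \<omega>) \<longlonglongrightarrow> xstar"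
proof -
  interpret M: prob_space M by fact
  have F_meas [measurable]: "f \<in> borel_measurable borel" "g \<in> borel_measurable borel"
    using lipschitz_on_continuous_on[OF f(4)] lipschitz_on_continuous_on[OF g(4)]
    by (auto intro: borel_measurable_continuous_onI)
  note [measurable] = measurable_prox[OF f(2,4) t] measurable_prox[OF g(2,4) t]
  define S where "S k = samples_before N Y W k" for k
  have Y_meas: "Y k i \<in> borel_measurable M" and W_meas: "W k i \<in> borel_measurable M"
    if "k \<ge> 1" "i \<in> {1..N k}" for k i
    using Y_law[OF that(1)] W_law[OF that(1)] that(2) by (auto simp: cond_iid_gaussian_def)
  have S_meas: "X \<in> borel_measurable M" if "X \<in> S k \<union> Y k ` {1..N k}" "k \<ge> 1" for X k
    using that Y_meas W_meas by (auto simp: S_def samples_before_def)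
  have S_mono: "S k \<union> Y k ` {1..N k} \<subseteq> S (Suc k)" if "k \<ge> 1" for k
    using that by (force simp: S_def samples_before_def)
  \<comment> \<open>The information before the first and before the second evaluation of iteration
    \<open>k\<close>. The second also contains the fresh samples \<open>Y k\<close>, on which the
    centre \<open>2 *\<^sub>R xhalf k \<omega> - z k \<omega>\<close> depends.\<close>
  define \<G> \<G>' where "\<G> k = generated_algebra M (S k)"
    and "\<G>' k = generated_algebra M (S k \<union> Y k ` {1..N k})" for k
  have sub: "subalgebra M (\<G> k)" "subalgebra M (\<G>' k)" if "k \<ge> 1" for k
    unfolding \<G>_def \<G>'_def using S_meas that by (blast intro: subalgebra_generated_algebra)+
  have xhalf_meas: "xhalf k \<in> borel_measurable (\<G>' k)" if k: "k \<ge> 1" for k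
  proof -
    have "(\<lambda>\<omega>. prox_estimator f (\<delta> k) (N k) (\<lambda>i. Y k i \<omega>)) \<in> borel_measurable (\<G>' k)"
      unfolding \<G>'_def using S_meas k
      by (intro measurable_prox_estimator F_meas measurable_generated_algebra) auto
    then show ?thesis
      by (rule measurable_cong[THEN iffD1, rotated]) (simp add: xhalf_step[OF k] \<G>'_def)
  qed
  have x_meas: "x (Suc k) \<in> borel_measurable (\<G> (Suc k))" if k: "k \<ge> 1" for k
  proof -
    have "W k i \<in> S (Suc k)" if "i \<in> {1..N k}" for i
      using that k by (force simp: S_def samples_before_def)
    then have "(\<lambda>\<omega>. prox_estimator g (\<delta> k) (N k) (\<lambda>i. W k i \<omega>)) \<in> borel_measurable (\<G> (Suc k))"
      unfolding \<G>_def using S_meas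
      by (intro measurable_prox_estimator F_meas measurable_generated_algebra) auto
    then show ?thesis
      by (rule measurable_cong[THEN iffD1, rotated]) (simp add: x_step[OF k] \<G>_def)
  qed
  have mono: "h \<in> borel_measurable (\<G>' k)" if "h \<in> borel_measurable (\<G> k)" for h :: "'w \<Rightarrow> real^'n" and k
    using that unfolding \<G>_def \<G>'_def by (rule measurable_generated_algebra_mono[rotated]) auto
  have mono': "h \<in> borel_measurable (\<G> (Suc k))" if "h \<in> borel_measurable (\<G>' k)" "k \<ge> 1"
    for h :: "'w \<Rightarrow> real^'n" and k
    using that(1) unfolding \<G>_def \<G>'_def by (rule measurable_generated_algebra_mono[OF S_mono[OF that(2)]])
  \<comment> \<open>The induction starts from the constant \<open>z1\<close>, and each update uses
    only \<open>xhalf k\<close> and \<open>x (Suc k)\<close>, known once iteration \<open>k\<close>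
    is complete.\<close>
  have z_meas: "z k \<in> borel_measurable (\<G> k)" if "k \<ge> 1" for k
    using that
  proof (induction k rule: dec_induct)
    case base
    have "(\<lambda>_. z1) \<in> borel_measurable (\<G> 1)" by simp
    then show ?case
      by (rule measurable_cong[THEN iffD1, rotated]) (simp add: z_init[simplified] \<G>_def)
  next
    case (step k)
    have "(\<lambda>\<omega>. z k \<omega> + x (Suc k) \<omega> - xhalf k \<omega>) \<in> borel_measurable (\<G> (Suc k))"
      using step(1) by (intro borel_measurable_add borel_measurable_diff x_meas mono' mono[OF step.IH] xhalf_meas)
    then show ?case
      by (rule measurable_cong[THEN iffD1, rotated]) (simp add: z_step[OF step(1)] \<G>_def)
  qed
  have center_meas: "(\<lambda>\<omega>. 2 *\<^sub>R xhalf k \<omega> - z k \<omega>) \<in> borel_measurable (\<G>' k)" if "k \<ge> 1" for k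
    using xhalf_meas[OF that] mono[OF z_meas[OF that]] by simp
  have [measurable]: "xhalf k \<in> borel_measurable M" "z k \<in> borel_measurable M"
    "x (Suc k) \<in> borel_measurable M" if "k \<ge> 1" for k
    using measurable_from_subalg[OF sub(2)[OF that] xhalf_meas[OF that]]
      measurable_from_subalg[OF sub(1)[OF that] z_meas[OF that]]
      measurable_from_subalg[OF sub(1) x_meas[OF that]] by auto
  define \<kappa> where "\<kappa> = (8 / 3 * 2 ^ CARD('n) :: real)"
  \<comment> \<open>A constant multiple, depending on the dimension alone, of the summand in
    \<open>err_sum\<close>: large enough for the concentration bound and still summable.\<close>
  define \<rho> where "\<rho> k = 2 * (1 + sqrt \<kappa>) * (sqrt (8 * J k * B k / (\<alpha> k * real (N k)))
    + sqrt (real CARD('n) * t * \<delta> k))" for k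
  define bad where "bad k = {\<omega> \<in> space M. \<rho> k < norm (xhalf k \<omega> - prox t f (z k \<omega>))}
    \<union> {\<omega> \<in> space M. \<rho> k < norm (x (Suc k) \<omega> - prox t g (2 *\<^sub>R xhalf k \<omega> - z k \<omega>))}" for k
  have bad_sets: "bad (Suc k) \<in> sets M" for k
    unfolding bad_def by measurable
  have bad_le: "measure M (bad k) \<le> 2 * (exp (4 * \<kappa>) * (1 + \<kappa>)) * \<alpha> k" if k: "k \<ge> 1" for k
  proof -
    have \<alpha>: "\<alpha> k > 0" using alpha[OF k] by simp
    have "measure M {\<omega> \<in> space M. \<rho> k < norm (xhalf k \<omega> - prox t f (z k \<omega>))} \<le> exp (4 * \<kappa>) * (1 + \<kappa>) * \<alpha> k"
      using prox_estimator_error_prob[OF f(2,4) t delta_pos[OF k] N_pos[OF k] \<alpha> J[OF k] B[OF k] N_ge[OF k] M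
          sub(1)[OF k] z_meas[OF k] Y_law[OF k, folded S_def, folded \<G>_def]]
      by (simp only: \<rho>_def \<kappa>_def xhalf_step[OF k] cong: conj_cong)
    moreover have "measure M {\<omega> \<in> space M. \<rho> k < norm (x (Suc k) \<omega> - prox t g (2 *\<^sub>R xhalf k \<omega> - z k \<omega>))}
        \<le> exp (4 * \<kappa>) * (1 + \<kappa>) * \<alpha> k"
      using prox_estimator_error_prob[OF g(2,4) t delta_pos[OF k] N_pos[OF k] \<alpha> J[OF k] B[OF k] N_ge[OF k] M
          sub(2)[OF k] center_meas[OF k] W_law[OF k, folded S_def, folded \<G>'_def]]
      by (simp only: \<rho>_def \<kappa>_def x_step[OF k] cong: conj_cong)
    moreover have "measure M (bad k) \<le> measure M {\<omega> \<in> space M. \<rho> k < norm (xhalf k \<omega> - prox t f (z k \<omega>))}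
        + measure M {\<omega> \<in> space M. \<rho> k < norm (x (Suc k) \<omega> - prox t g (2 *\<^sub>R xhalf k \<omega> - z k \<omega>))}"
      unfolding bad_def using k by (intro measure_Un_le) measurable
    ultimately show ?thesis by linarith
  qed
  have \<rho>_sum: "summable (\<lambda>k. \<rho> (Suc k))" unfolding \<rho>_def by (intro summable_mult err_sum)
  \<comment> \<open>All sequences are shifted by one because the hypotheses start at index
    1.\<close>
  have "AE \<omega> in M. eventually (\<lambda>k. \<omega> \<in> space M - bad (Suc k)) sequentially"
  proof (rule borel_cantelli_AE1[OF bad_sets])
    show "summable (\<lambda>k. measure M (bad (Suc k)))"
      by (rule summable_comparison_test'[OF summable_mult[OF alpha_sum], where N = 0])
        (use bad_le in \<open>auto simp: measure_nonneg\<close>)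
  qed (simp add: M.emeasure_eq_measure)
  then show ?thesis
  proof (eventually_elim)
    case (elim \<omega>)
    then have \<omega>: "\<omega> \<in> space M" by (auto dest: eventually_happens)
    \<comment> \<open>For this \<open>\<omega>\<close> only finitely many bad events occur, so the
      errors are eventually at most \<open>\<rho>\<close>, which is enough for the comparison
      test.\<close>
    have err: "eventually (\<lambda>k. norm (xhalf (Suc k) \<omega> - prox t f (z (Suc k) \<omega>)) \<le> \<rho> (Suc k)) sequentially"
      "eventually (\<lambda>k. norm (x (Suc (Suc k)) \<omega> - prox t g (2 *\<^sub>R xhalf (Suc k) \<omega> - z (Suc k) \<omega>)) \<le> \<rho> (Suc k)) sequentially"
      using elim by (auto elim!: eventually_mono simp: bad_def not_less)
    obtain q where q: "is_arg_min (\<lambda>u. f u + g u) (\<lambda>_. True) q" using argmin by blast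
    have q_min: "f q + g q \<le> f u + g u" for u
      using q by (auto simp: is_arg_min_def not_less)
    obtain p where p: "\<And>u. f p + g p \<le> f u + g u" "(\<lambda>k. x (Suc k) \<omega>) \<longlonglongrightarrow> p"
    proof -
      have "\<exists>p. (\<forall>u. f p + g p \<le> f u + g u) \<and> (\<lambda>k. x (Suc k) \<omega>) \<longlonglongrightarrow> p"
      proof (rule inexact_Douglas_Rachford_converges[OF f(2,4) g(2,4) t q_min])
        show "summable (\<lambda>k. norm (xhalf (Suc k) \<omega> - prox t f (z (Suc k) \<omega>)))"
          by (rule summable_comparison_test_ev[OF _ \<rho>_sum]) (use err(1) in simp)
        show "summable (\<lambda>k. norm (x (Suc (Suc k)) \<omega> - prox t g (2 *\<^sub>R xhalf (Suc k) \<omega> - z (Suc k) \<omega>)))"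
          by (rule summable_comparison_test_ev[OF _ \<rho>_sum]) (use err(2) in simp)
        show "z (Suc (Suc k)) \<omega> = z (Suc k) \<omega> + x (Suc (Suc k)) \<omega> - xhalf (Suc k) \<omega>" for k
          using \<omega> by (simp add: z_step)
      qed
      then show ?thesis using that by blast
    qed
    have "is_arg_min (\<lambda>u. f u + g u) (\<lambda>_. True) p" using p(1) by (auto simp: is_arg_min_def not_less)
    moreover have "(\<lambda>k. x k \<omega>) \<longlonglongrightarrow> p" by (rule LIMSEQ_imp_Suc[OF p(2)])
    ultimately show ?case by blast
  qed
qed

end
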